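(* For $d\in\mathbb N\cup\{\infty\}$ let $U_N^d=\{g\in U_N\,|\,\det g\in\mathbb Z_d\}$. Then the easy envelope of $U_N^d$ is $U_N$, for any $d\geq1$.
   Context: $\mathbb Z_d\subset\mathbb T$ is the group of $d$-th roots of unity, with $\mathbb Z_\infty=\mathbb T$, so that $U_N^1=SU_N$ and $U_N^\infty=U_N$. $C(U_N^+)$ is the universal $C^*$-algebra generated by the entries of an $N\times N$ matrix $u=(u_{ij})$ subject to $u^*=u^{-1}$, $u^t=\bar u^{-1}$, with its standard compact quantum group structure; $U_N\subset U_N^+$, and $S_N\subset U_N$ via the permutation matrices. Closed subgroups $G\subset U_N^+$ correspond to quotients of $C(U_N^+)$ compatible with comultiplication, counit and antipode. Colored integers are finite words in $\circ,\bullet$; $u^{\otimes k}$ is defined by $u^\circ=u$, $u^\bullet=\bar u$ and multiplicativity. The Tannakian category of $G$ is $C(k,l)=Hom(u^{\otimes k},u^{\otimes l})$, and determines $G$. $P(k,l)$ is the set of partitions of an upper row of points colored by $k$ and a lower row of points colored by $l$. For $\pi\in P(k,l)$, $T_\pi(e_{i_1}\otimes\ldots\otimes e_{i_k})=\sum_{j_1\ldots j_l}\delta_\pi(i;j)\,e_{j_1}\otimes\ldots\otimes e_{j_l}$, where $\delta_\pi(i;j)=1$ if each block of $\pi$ contains equal indices, and $0$ otherwise. Easy envelope: for a closed subgroup $G\subset U_N^+$ with Tannakian category $C$, the sets $D^1(k,l)=\{\pi\in P(k,l)\,|\,T_\pi\in C(k,l)\}$ form a category of partitions, and the easy envelope $S_N\subset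 G^1\subset U_N^+$ is the quantum group with Tannakian category $span(T_\pi|\pi\in D^1(k,l))$. When $G$ is homogeneous, $S_N\subset G\subset U_N^+$ (which is the case for $U_N^d$ when $2|d$), $G^1$ is the smallest easy quantum group containing $G$.
   Formalization: The case N = 1 with d finite is excluded, because there U_1^d = Z_d is its own easy envelope and the claim fails; all N ≥ 2 with any d ≥ 1, and N = 1 with d = ∞, are covered. *)

theory Defs
  imports
    "HOL-Analysis.Analysis"
    "HOL-Library.Poly_Mapping"
    "HOL-Library.Disjoint_Sets"
    "HOL-Library.Extended_Nat"
begin

text \<open>
  The size \<open>N\<close> of the matrices is \<open>CARD('n)\<close>, for an arbitrary finite index type \<open>'n\<close>.
\<close>

datatype color = White | Black

text \<open>
  A colored integer is a word in the two colors. \<open>White\<close> marks \<open>u\<close> and \<open>Black\<close> marks its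
  entrywise adjoint.
\<close>

type_synonym colored = "color list"

fun flip :: "color \<Rightarrow> color" where
  "flip White = Black"
| "flip Black = White"


section \<open>The free star-algebra on the entries of u\<close>

text \<open>
  The letter \<open>(White, i, j)\<close> stands for \<open>u_ij\<close> and \<open>(Black, i, j)\<close> for its adjoint. Words are
  wrapped in a datatype so that they form a \<open>monoid_add\<close> under concatenation. Finitely supported
  complex functions on words then form, with the convolution product of \<open>Poly_Mapping\<close>, the free
  unital star-algebra \<open>F\<close> on the \<open>u_ij\<close>, and finitely supported functions on pairs of words form
  the algebraic tensor product of \<open>F\<close> with itself.
\<close>

datatype 'n uword = Word (letters: "(color \<times> 'n \<times> 'n) list")

instantiation uword :: (type) monoid_add
begin

definition zero_uword :: "'a uword" where
  "0 = Word []"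

definition plus_uword :: "'a uword \<Rightarrow> 'a uword \<Rightarrow> 'a uword" where
  "v + w = Word (letters v @ letters w)"

instance
  by standard (simp_all add: zero_uword_def plus_uword_def)

end

type_synonym 'n free_alg = "'n uword \<Rightarrow>\<^sub>0 complex"
type_synonym 'n free_alg2 = "('n uword \<times> 'n uword) \<Rightarrow>\<^sub>0 complex"

definition scal :: "complex \<Rightarrow> ('a::monoid_add \<Rightarrow>\<^sub>0 complex) \<Rightarrow> ('a \<Rightarrow>\<^sub>0 complex)" where
  "scal c x = Poly_Mapping.single 0 c * x"

definition gen :: "color \<Rightarrow> 'n \<Rightarrow> 'n \<Rightarrow> 'n free_alg" where
  "gen c i j = Poly_Mapping.single (Word [(c, i, j)]) 1"

definition adj_word :: "'n uword \<Rightarrow> 'n uword" where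
  "adj_word w = Word (rev (map (\<lambda>(c, i, j). (flip c, i, j)) (letters w)))"

definition star :: "'n free_alg \<Rightarrow> 'n free_alg" where
  "star x = (\<Sum>w\<in>Poly_Mapping.keys x.
     Poly_Mapping.single (adj_word w) (cnj (Poly_Mapping.lookup x w)))"

definition star2 :: "'n free_alg2 \<Rightarrow> 'n free_alg2" where
  "star2 z = (\<Sum>(v, w)\<in>Poly_Mapping.keys z.
     Poly_Mapping.single (adj_word v, adj_word w) (cnj (Poly_Mapping.lookup z (v, w))))"

text \<open>Evaluation of a noncommutative star-polynomial in the \<open>u_ij\<close> at a scalar matrix.\<close>

definition ev :: "complex^'n^'n \<Rightarrow> 'n free_alg \<Rightarrow> complex" where
  "ev g x = (\<Sum>w\<in>Poly_Mapping.keys x. Poly_Mapping.lookup x w *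
     (\<Prod>(c, i, j)\<leftarrow>letters w. case c of White \<Rightarrow> g $ i $ j | Black \<Rightarrow> cnj (g $ i $ j)))"

text \<open>
  The counit sends \<open>u_ij\<close> to \<open>\<delta>_ij\<close>, the antipode is the antimultiplicative linear map
  sending \<open>u_ij\<close> to the adjoint of \<open>u_ji\<close> and the adjoint of \<open>u_ij\<close> to \<open>u_ji\<close>, and the
  comultiplication sends \<open>u_ij\<close> to the sum of all \<open>u_im \<otimes> u_mj\<close>, and likewise for adjoints.
\<close>

definition counit :: "('n::finite) free_alg \<Rightarrow> complex" where
  "counit = ev (mat 1)"

definition antipode :: "'n free_alg \<Rightarrow> 'n free_alg" where
  "antipode x = (\<Sum>w\<in>Poly_Mapping.keys x.
     Poly_Mapping.single (Word (rev (map (\<lambda>(c, i, j). (flip c, j, i)) (letters w))))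
       (Poly_Mapping.lookup x w))"

definition comult :: "('n::finite) free_alg \<Rightarrow> 'n free_alg2" where
  "comult x = (\<Sum>w\<in>Poly_Mapping.keys x. scal (Poly_Mapping.lookup x w)
     (\<Prod>(c, i, j)\<leftarrow>letters w.
        \<Sum>m\<in>UNIV. Poly_Mapping.single (Word [(c, i, m)], Word [(c, m, j)]) 1))"


section \<open>Closed subgroups of the free unitary quantum group\<close>

text \<open>
  By the universal property of \<open>C(U_N^+)\<close>, its quotients are the completions of \<open>F\<close> with respect
  to the C*-seminorms which vanish on the relations saying that \<open>u\<close> and its transpose are
  unitary. A quotient of \<open>C(U_N^+)\<close> is therefore represented by the seminorm \<open>p\<close> that its norm
  induces on \<open>F\<close>. An identity between elements of \<open>F\<close> holds in the quotient iff \<open>p\<close> vanishes on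
  the difference of the two sides.
\<close>

definition cstar_seminorm :: "('n free_alg \<Rightarrow> real) \<Rightarrow> bool" where
  "cstar_seminorm p \<longleftrightarrow>
     (\<forall>x y. p (x + y) \<le> p x + p y) \<and>
     (\<forall>c x. p (scal c x) = cmod c * p x) \<and>
     (\<forall>x y. p (x * y) \<le> p x * p y) \<and>
     (\<forall>x. p (star x * x) = (p x)\<^sup>2)"

definition biunitary :: "(('n::finite) free_alg \<Rightarrow> real) \<Rightarrow> bool" where
  "biunitary p \<longleftrightarrow> (\<forall>i j.
     p ((\<Sum>m\<in>UNIV. gen White i m * gen Black j m) - (if i = j then 1 else 0)) = 0 \<and>
     p ((\<Sum>m\<in>UNIV. gen Black m i * gen White m j) - (if i = j then 1 else 0)) = 0 \<and>
     p ((\<Sum>m\<in>UNIV. gen White m i * gen Black m j) - (if i = j then 1 else 0)) = 0 \<and>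
     p ((\<Sum>m\<in>UNIV. gen Black i m * gen White j m) - (if i = j then 1 else 0)) = 0)"

text \<open>States of the C*-algebra \<open>A\<close> given by \<open>p\<close>, restricted to \<open>F\<close>.\<close>

definition state :: "('n free_alg \<Rightarrow> real) \<Rightarrow> ('n free_alg \<Rightarrow> complex) \<Rightarrow> bool" where
  "state p \<phi> \<longleftrightarrow>
     (\<forall>x y. \<phi> (x + y) = \<phi> x + \<phi> y) \<and>
     (\<forall>c x. \<phi> (scal c x) = c * \<phi> x) \<and>
     (\<forall>x. cmod (\<phi> x) \<le> p x) \<and>
     (\<forall>x. \<phi> (star x * x) \<in> \<real>\<^sub>\<ge>\<^sub>0) \<and>
     \<phi> 1 = 1"

definition tensor_functional ::
  "('n free_alg \<Rightarrow> complex) \<Rightarrow> ('n free_alg \<Rightarrow> complex) \<Rightarrow> 'n free_alg2 \<Rightarrow> complex" where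
  "tensor_functional \<phi> \<psi> z = (\<Sum>(v, w)\<in>Poly_Mapping.keys z. Poly_Mapping.lookup z (v, w) *
     (\<phi> (Poly_Mapping.single v 1) * \<psi> (Poly_Mapping.single w 1)))"

text \<open>
  \<open>min_tensor_norm_le p z c\<close> (for \<open>c \<ge> 0\<close>) says that \<open>z\<close> has norm at most \<open>c\<close> in the minimal
  (spatial) C*-tensor square of \<open>A\<close>. This norm is the supremum, over all pairs of states of \<open>A\<close>,
  of the operator norm of \<open>z\<close> in the GNS representation of the product state. That representation
  is the tensor product of the two GNS representations, and the classes of the elements \<open>y\<close> of the
  algebraic tensor product are dense in its space.
\<close>

definition min_tensor_norm_le :: "('n free_alg \<Rightarrow> real) \<Rightarrow> 'n free_alg2 \<Rightarrow> real \<Rightarrow> bool" where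
  "min_tensor_norm_le p z c \<longleftrightarrow> (\<forall>\<phi> \<psi> y. state p \<phi> \<longrightarrow> state p \<psi> \<longrightarrow>
     Re (tensor_functional \<phi> \<psi> (star2 y * star2 z * z * y))
       \<le> c\<^sup>2 * Re (tensor_functional \<phi> \<psi> (star2 y * y)))"

text \<open>
  A map defined on the generators extends to the quotient iff it is contractive for the respective
  seminorms. The opposite algebra, the target of the antipode, has the same norm.
\<close>

definition closed_quantum_subgroup :: "(('n::finite) free_alg \<Rightarrow> real) \<Rightarrow> bool" where
  "closed_quantum_subgroup p \<longleftrightarrow>
     cstar_seminorm p \<and> biunitary p \<and>
     (\<forall>x. min_tensor_norm_le p (comult x) (p x)) \<and>
     (\<forall>x. cmod (counit x) \<le> p x) \<and>
     (\<forall>x. p (antipode x) \<le> p x)"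

text \<open>
  Inclusion of quantum groups: the map \<open>u_ij \<mapsto> u_ij\<close> from the algebra of the larger one to that
  of the smaller one is well defined.
\<close>

definition quantum_subgroup_of ::
  "('n free_alg \<Rightarrow> real) \<Rightarrow> ('n free_alg \<Rightarrow> real) \<Rightarrow> bool" where
  "quantum_subgroup_of p q \<longleftrightarrow> (\<forall>x. p x \<le> q x)"

text \<open>
  A compact group \<open>G\<close> of unitary matrices, viewed as a quantum group: \<open>C(G)\<close> with its supremum norm
  and with \<open>u_ij\<close> the coordinate functions.
\<close>

definition classical :: "(complex^'n^'n) set \<Rightarrow> 'n free_alg \<Rightarrow> real" where
  "classical G x = (SUP g\<in>G. cmod (ev g x))"


section \<open>Tannakian categories, partitions and easy envelopes\<close>

text \<open>
  Matrices from the \<open>k\<close>-th to the \<open>l\<close>-th tensor power of the standard space are functions of a row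
  multi-index (of length \<open>length l\<close>) and a column multi-index (of length \<open>length k\<close>), vanishing
  on index lists of other lengths.
\<close>

fun u_pow :: "colored \<Rightarrow> 'n list \<Rightarrow> 'n list \<Rightarrow> 'n free_alg" where
  "u_pow [] [] [] = 1"
| "u_pow (c # k) (i # is) (j # js) = gen c i j * u_pow k is js"
| "u_pow _ _ _ = 0"

definition tannaka_hom ::
  "(('n::finite) free_alg \<Rightarrow> real) \<Rightarrow> colored \<Rightarrow> colored \<Rightarrow> ('n list \<Rightarrow> 'n list \<Rightarrow> complex) set" where
  "tannaka_hom p k l = {T.
     (\<forall>j i. T j i \<noteq> 0 \<longrightarrow> length j = length l \<and> length i = length k) \<and>
     (\<forall>j i. length j = length l \<longrightarrow> length i = length k \<longrightarrow>
        p ((\<Sum>m | length m = length k. scal (T j m) (u_pow k m i))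
           - (\<Sum>m | length m = length l. scal (T m i) (u_pow l j m))) = 0)}"

text \<open>The upper points are \<open>Inl 0, Inl 1, \<dots>\<close>, the lower points \<open>Inr 0, Inr 1, \<dots>\<close>.\<close>

definition partitions :: "colored \<Rightarrow> colored \<Rightarrow> (nat + nat) set set set" where
  "partitions k l = {\<pi>. partition_on ({..<length k} <+> {..<length l}) \<pi>}"

definition T_part ::
  "colored \<Rightarrow> colored \<Rightarrow> (nat + nat) set set \<Rightarrow> 'n list \<Rightarrow> 'n list \<Rightarrow> complex" where
  "T_part k l \<pi> j i =
     (if length j = length l \<and> length i = length k \<and>
         (\<forall>B\<in>\<pi>. \<forall>x\<in>B. \<forall>y\<in>B. case_sum ((!) i) ((!) j) x = case_sum ((!) i) ((!) j) y)
      then 1 else 0)"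

definition D1 ::
  "(('n::finite) free_alg \<Rightarrow> real) \<Rightarrow> colored \<Rightarrow> colored \<Rightarrow> (nat + nat) set set set" where
  "D1 p k l = {\<pi> \<in> partitions k l. T_part k l \<pi> \<in> tannaka_hom p k l}"

definition span_T ::
  "colored \<Rightarrow> colored \<Rightarrow> (nat + nat) set set set \<Rightarrow> ('n list \<Rightarrow> 'n list \<Rightarrow> complex) set" where
  "span_T k l D = {T. \<exists>a. T = (\<lambda>j i. \<Sum>\<pi>\<in>D. a \<pi> * T_part k l \<pi> j i)}"

definition permutation_group :: "(complex^'n^'n) set" where
  "permutation_group = {(\<chi> i j. if i = \<sigma> j then 1 else 0) | \<sigma>. bij \<sigma>}"

text \<open>
  \<open>is_easy_envelope p q\<close>: the quantum group \<open>q\<close> is the easy envelope of \<open>p\<close>. It is a relation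
  because one quantum group may have several C*-completions, all with the same Tannakian category.
\<close>

definition is_easy_envelope ::
  "(('n::finite) free_alg \<Rightarrow> real) \<Rightarrow> ('n free_alg \<Rightarrow> real) \<Rightarrow> bool" where
  "is_easy_envelope p q \<longleftrightarrow>
     closed_quantum_subgroup p \<and> closed_quantum_subgroup q \<and>
     quantum_subgroup_of (classical permutation_group) q \<and>
     (\<forall>k l. tannaka_hom q k l = span_T k l (D1 p k l))"


section \<open>The groups\<close>

definition unitary_group :: "(complex^'n^'n) set" where
  "unitary_group = {g. g ** map_matrix cnj (transpose g) = mat 1 \<and>
                       map_matrix cnj (transpose g) ** g = mat 1}"

definition root_group :: "enat \<Rightarrow> complex set" where
  "root_group d = (case d of enat n \<Rightarrow> {z. z ^ n = 1} | \<infinity> \<Rightarrow> {z. cmod z = 1})"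

definition unitary_group_det :: "enat \<Rightarrow> (complex^'n^'n) set" where
  "unitary_group_det d = {g \<in> unitary_group. det g \<in> root_group d}"

end

theory Submission
  imports Defs
begin

text \<open>
  Write \<open>U\<close> for the unitary group and \<open>U\<^sup>d\<close> for the subgroup given by the determinant. The category of
  partitions of \<open>U\<^sup>d\<close> must be shown to span exactly the intertwiner spaces of \<open>U\<close>.

  \<^bold>\<open>Intertwiners of U are spanned by partitions of \<open>U\<^sup>d\<close>.\<close> This is the first fundamental theorem of
  invariant theory for \<open>U\<close>: every intertwiner is a combination of the maps \<open>T_\<pi>\<close>, where \<open>\<pi>\<close> pairs points
  at which the group acts by \<open>g\<close> with points at which it acts by the complex conjugate of \<open>g\<close>. An
  intertwiner is rewritten as a tensor \<open>t\<close> fixed by the group (\<open>intertwines_iff_invariant\<close>), and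
  differentiating along the one-parameter subgroups \<open>\<theta> \<mapsto> 1 + (e\<^sup>i\<^sup>\<theta> - 1) v v\<^sup>*\<close> makes \<open>t\<close> invariant under the
  Lie algebra of all complex matrices (\<open>gl_invariant_of_invariant\<close>). The theorem
  \<open>gl_invariant_in_span_matchings\<close> is then an induction on the number of conjugate points. The tensor
  splits into a combination of matchings and a remainder \<open>r\<close> orthogonal to all of them. Let \<open>R_ab\<close> be
  the action of an elementary matrix on the tensor factors at the conjugate points, so that \<open>R_ba\<close> is
  the adjoint of \<open>R_ab\<close>. Moving one operator through the invariance relation turns the Casimir sum
  \<open>Z = \<Sum> R_ba R_ab r\<close> into a sum of partial traces of \<open>r\<close> multiplied by matchings of two points, hence,
  by induction, into a combination of matchings. So \<open>\<langle>Z, r\<rangle> = 0\<close>; but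
  \<open>\<langle>Z, r\<rangle> = \<Sum> \<parallel>R_ab r\<parallel>\<^sup>2\<close>, so all \<open>R_ab r\<close> vanish. As \<open>\<Sum> R_aa\<close> multiplies by the number of
  conjugate points, \<open>r = 0\<close>. No Haar measure and no double commutant theorem are needed.

  \<^bold>\<open>Partitions of \<open>U\<^sup>d\<close> are partitions of U.\<close> For \<open>d = \<infinity>\<close> the groups coincide. If \<open>T_\<pi>\<close> intertwines
  for the special unitary group and \<open>N \<ge> 2\<close>, evaluate the relation at the diagonal matrix with entries
  \<open>z, z\<^sup>-\<^sup>1, 1, \<dots>\<close> and at the constant word of the first index: the entry of \<open>T_\<pi>\<close> there is 1, so the
  scalar \<open>z\<close> acts in the same way on source and target. Every unitary matrix is a scalar times one of
  determinant 1, so \<open>T_\<pi>\<close> intertwines for \<open>U\<close> (\<open>T_part_in_tannaka_hom_unitary_group\<close>).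

  \<^bold>\<open>Groups of unitary matrices are closed quantum subgroups\<close> (\<open>closed_quantum_subgroup_classical\<close>). Only
  the comultiplication needs an argument. A contractive unital functional on a function algebra
  maps functions with nonnegative real part to numbers with nonnegative real part, and so does the
  product of two of them, one variable at a time. Applied to \<open>y\<^sup>* (c\<^sup>2 - z\<^sup>* z) y\<close>, which is nonnegative on
  \<open>G \<times> G\<close> when \<open>|z| \<le> c\<close>, this bounds the minimal tensor norm without the Riesz representation theorem.
\<close>

section \<open>Evaluation on the free star-algebra and its tensor square\<close>

text \<open>
  The linear functional on finitely supported functions with prescribed values on the point masses.
\<close>

definition linear_ext :: "('a \<Rightarrow> complex) \<Rightarrow> ('a \<Rightarrow>\<^sub>0 complex) \<Rightarrow> complex" where
  "linear_ext F x = (\<Sum>w\<in>Poly_Mapping.keys x. Poly_Mapping.lookup x w * F w)"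

lemma linear_ext_superset:
  assumes "finite S" "Poly_Mapping.keys x \<subseteq> S"
  shows "linear_ext F x = (\<Sum>w\<in>S. Poly_Mapping.lookup x w * F w)"
  unfolding linear_ext_def using assms
  by (intro sum.mono_neutral_left) (auto simp: in_keys_iff)

lemma linear_ext_zero [simp]: "linear_ext F 0 = 0"
  by (simp add: linear_ext_def)

lemma linear_ext_add: "linear_ext F (x + y) = linear_ext F x + linear_ext F y"
proof -
  let ?S = "Poly_Mapping.keys x \<union> Poly_Mapping.keys y"
  have "Poly_Mapping.keys (x + y) \<subseteq> ?S" by (rule keys_add)
  then show ?thesis
    by (simp add: linear_ext_superset[of ?S] lookup_add ring_distribs sum.distrib)
qed

lemma linear_ext_sum: "linear_ext F (sum f I) = (\<Sum>i\<in>I. linear_ext F (f i))"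
  by (induction I rule: infinite_finite_induct) (simp_all add: linear_ext_add)

lemma linear_ext_single [simp]: "linear_ext F (Poly_Mapping.single w c) = c * F w"
  by (cases "c = 0") (simp_all add: linear_ext_def)

lemma linear_ext_diff: "linear_ext F (x - y) = linear_ext F x - linear_ext F y"
  using linear_ext_add[of F "x - y" y] by simp

lemma poly_mapping_expansion:
  "x = (\<Sum>w\<in>Poly_Mapping.keys x. Poly_Mapping.single w (Poly_Mapping.lookup x w))"
proof (rule poly_mapping_eqI)
  fix k
  show "Poly_Mapping.lookup x k = Poly_Mapping.lookup
      (\<Sum>w\<in>Poly_Mapping.keys x. Poly_Mapping.single w (Poly_Mapping.lookup x w)) k"
    by (simp add: lookup_sum lookup_single when_def in_keys_iff)
qed

lemma linear_ext_mult:
  assumes "\<And>v w. F (v + w) = F v * F w"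
  shows "linear_ext F (x * y) = linear_ext F x * linear_ext F y"
proof -
  have "linear_ext F (x * y) = linear_ext F (\<Sum>v\<in>Poly_Mapping.keys x. \<Sum>w\<in>Poly_Mapping.keys y.
      Poly_Mapping.single (v + w) (Poly_Mapping.lookup x v * Poly_Mapping.lookup y w))"
    by (subst poly_mapping_expansion[of x], subst poly_mapping_expansion[of y])
      (simp only: sum_product mult_single)
  then show ?thesis
    unfolding linear_ext_sum linear_ext_single assms
    by (simp add: linear_ext_def sum_product mult_ac)
qed

lemma linear_ext_scal: "linear_ext F (scal c x) = c * linear_ext F x"
proof -
  have "scal c x = (\<Sum>w\<in>Poly_Mapping.keys x. Poly_Mapping.single w (c * Poly_Mapping.lookup x w))"
    unfolding scal_def
    by (subst poly_mapping_expansion[of x]) (simp add: sum_distrib_left mult_single)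
  then show ?thesis
    by (simp only: linear_ext_sum linear_ext_single) (simp add: linear_ext_def sum_distrib_left mult.assoc)
qed

lemma linear_ext_one: "F 0 = 1 \<Longrightarrow> linear_ext F 1 = 1"
  by (simp flip: single_one)

text \<open>
  The coordinate function of the letter \<open>(c, i, j)\<close>; \<open>word_ev\<close> is the corresponding monomial.
\<close>

definition entry :: "complex^'n^'n \<Rightarrow> color \<Rightarrow> 'n \<Rightarrow> 'n \<Rightarrow> complex" where
  "entry g c i j = (case c of White \<Rightarrow> g $ i $ j | Black \<Rightarrow> cnj (g $ i $ j))"

definition word_ev :: "complex^'n^'n \<Rightarrow> 'n uword \<Rightarrow> complex" where
  "word_ev g w = (\<Prod>(c, i, j)\<leftarrow>letters w. entry g c i j)"

lemma word_ev_add: "word_ev g (v + w) = word_ev g v * word_ev g w"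
  by (simp add: word_ev_def plus_uword_def)

lemma word_ev_zero: "word_ev g 0 = 1"
  by (simp add: word_ev_def zero_uword_def)

lemma ev_eq: "ev g = linear_ext (word_ev g)"
  by (simp add: fun_eq_iff ev_def linear_ext_def word_ev_def entry_def)

lemma ev_zero [simp]: "ev g 0 = 0"
  and ev_one [simp]: "ev g 1 = 1"
  and ev_add: "ev g (x + y) = ev g x + ev g y"
  and ev_diff: "ev g (x - y) = ev g x - ev g y"
  and ev_mult: "ev g (x * y) = ev g x * ev g y"
  and ev_scal: "ev g (scal c x) = c * ev g x"
  and ev_sum: "ev g (sum f I) = (\<Sum>i\<in>I. ev g (f i))"
  and ev_single: "ev g (Poly_Mapping.single w c) = c * word_ev g w"
  unfolding ev_eq
  by (simp_all add: linear_ext_one word_ev_zero linear_ext_add linear_ext_diff linear_ext_sum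
      linear_ext_mult word_ev_add linear_ext_scal)

lemma ev_gen [simp]: "ev g (gen c i j) = entry g c i j"
  by (simp add: gen_def ev_single word_ev_def)

lemma entry_flip: "entry g (flip c) i j = cnj (entry g c i j)"
  by (cases c) (simp_all add: entry_def)

lemma word_ev_adj: "word_ev g (adj_word w) = cnj (word_ev g w)"
proof -
  have "(\<Prod>(c, i, j)\<leftarrow>map (\<lambda>(c, i, j). (flip c, i, j)) l. entry g c i j) =
      cnj (\<Prod>(c, i, j)\<leftarrow>l. entry g c i j)" for l
    by (induction l) (auto simp: entry_flip)
  then show ?thesis
    by (simp add: word_ev_def adj_word_def rev_map[symmetric] prod_list.rev)
qed

lemma ev_star: "ev g (star x) = cnj (ev g x)"
  unfolding star_def ev_sum ev_single
  by (simp add: ev_eq linear_ext_def word_ev_adj)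

text \<open>
  The conjugate transpose.
\<close>

definition adj_mat :: "complex^'n^'n \<Rightarrow> complex^'n^'n" where
  "adj_mat g = map_matrix cnj (transpose g)"

lemma adj_mat_nth [simp]: "adj_mat g $ i $ j = cnj (g $ j $ i)"
  by (simp add: adj_mat_def map_matrix_def transpose_def)

lemma entry_adj_mat: "entry (adj_mat g) c i j = entry g (flip c) j i"
  by (cases c) (simp_all add: entry_def)

lemma ev_antipode: "ev g (antipode x) = ev (adj_mat g) x"
proof -
  have "(\<Prod>(c, i, j)\<leftarrow>map (\<lambda>(c, i, j). (flip c, j, i)) l. entry g c i j) =
      (\<Prod>(c, i, j)\<leftarrow>l. entry (adj_mat g) c i j)" for l
    by (induction l) (auto simp: entry_adj_mat)
  then have "word_ev g (Word (rev (map (\<lambda>(c, i, j). (flip c, j, i)) (letters w)))) =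
      word_ev (adj_mat g) w" for w
    by (simp add: word_ev_def rev_map[symmetric] prod_list.rev)
  then show ?thesis
    unfolding antipode_def ev_sum ev_single by (simp add: ev_eq linear_ext_def)
qed

text \<open>
  Evaluation of the algebraic tensor square at a pair of matrices.
\<close>

definition ev2 :: "complex^'n^'n \<Rightarrow> complex^'n^'n \<Rightarrow> 'n free_alg2 \<Rightarrow> complex" where
  "ev2 g h = linear_ext (\<lambda>(v, w). word_ev g v * word_ev h w)"

lemma ev2_one [simp]: "ev2 g h 1 = 1"
  and ev2_diff: "ev2 g h (x - y) = ev2 g h x - ev2 g h y"
  and ev2_mult: "ev2 g h (x * y) = ev2 g h x * ev2 g h y"
  and ev2_scal: "ev2 g h (scal c x) = c * ev2 g h x"
  and ev2_sum: "ev2 g h (sum f I) = (\<Sum>i\<in>I. ev2 g h (f i))"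
  and ev2_single: "ev2 g h (Poly_Mapping.single (v, w) c) = c * (word_ev g v * word_ev h w)"
proof -
  let ?F = "\<lambda>(v, w). word_ev g v * word_ev h w"
  have m: "?F (a + b) = ?F a * ?F b" for a b
    by (cases a; cases b) (simp add: word_ev_add)
  have z: "?F 0 = 1" by (simp add: word_ev_zero zero_prod_def)
  show "ev2 g h 1 = 1" "ev2 g h (x - y) = ev2 g h x - ev2 g h y"
    "ev2 g h (x * y) = ev2 g h x * ev2 g h y" "ev2 g h (scal c x) = c * ev2 g h x"
    "ev2 g h (sum f I) = (\<Sum>i\<in>I. ev2 g h (f i))"
    "ev2 g h (Poly_Mapping.single (v, w) c) = c * (word_ev g v * word_ev h w)"
    unfolding ev2_def
    by (simp_all add: linear_ext_one[of ?F, OF z] linear_ext_diff linear_ext_sum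
      linear_ext_mult[of ?F, OF m] linear_ext_scal)
qed

lemma ev2_star2: "ev2 g h (star2 z) = cnj (ev2 g h z)"
  unfolding star2_def ev2_sum case_prod_unfold ev2_single word_ev_adj
  by (simp add: ev2_def linear_ext_def case_prod_unfold)

lemma entry_mult: "entry (g ** h) c i j = (\<Sum>m\<in>UNIV. entry g c i m * entry h c m j)"
  by (cases c) (simp_all add: entry_def matrix_matrix_mult_def)

lemma ev2_comult: "ev2 g h (comult x) = ev (g ** h) x"
proof -
  have "ev2 g h (\<Prod>(c, i, j)\<leftarrow>l. \<Sum>m\<in>UNIV.
      Poly_Mapping.single (Word [(c, i, m)], Word [(c, m, j)]) 1) =
      (\<Prod>(c, i, j)\<leftarrow>l. entry (g ** h) c i j)" for l
    by (induction l) (auto simp: ev2_mult ev2_sum ev2_single entry_mult word_ev_def)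
  then show ?thesis
    unfolding comult_def ev2_sum ev2_scal by (simp add: ev_eq linear_ext_def word_ev_def)
qed

section \<open>Groups of unitary matrices as closed quantum subgroups\<close>

text \<open>
  Subgroups of the unitary group. Closedness is not required, since only the supremum seminorm on
  polynomial functions matters.
\<close>

definition unitary_subgroup :: "(complex^'n^'n) set \<Rightarrow> bool" where
  "unitary_subgroup G \<longleftrightarrow> G \<subseteq> unitary_group \<and> mat 1 \<in> G \<and>
     (\<forall>g\<in>G. \<forall>h\<in>G. g ** h \<in> G) \<and> (\<forall>g\<in>G. adj_mat g \<in> G)"

lemma unitary_group_iff:
  "g \<in> unitary_group \<longleftrightarrow> g ** adj_mat g = mat 1 \<and> adj_mat g ** g = mat 1"
  by (simp add: unitary_group_def adj_mat_def)

lemma unitary_rows: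
  assumes "g \<in> unitary_group"
  shows "(\<Sum>m\<in>UNIV. g $ i $ m * cnj (g $ j $ m)) = (if i = j then 1 else 0)"
    and "(\<Sum>m\<in>UNIV. cnj (g $ m $ i) * g $ m $ j) = (if i = j then 1 else 0)"
proof -
  have "(g ** adj_mat g) $ i $ j = mat 1 $ i $ j" "(adj_mat g ** g) $ i $ j = mat 1 $ i $ j"
    using assms by (simp_all add: unitary_group_iff)
  then show "(\<Sum>m\<in>UNIV. g $ i $ m * cnj (g $ j $ m)) = (if i = j then 1 else 0)"
    "(\<Sum>m\<in>UNIV. cnj (g $ m $ i) * g $ m $ j) = (if i = j then 1 else 0)"
    by (simp_all add: matrix_matrix_mult_def mat_def)
qed

lemma unitary_entry_le_1:
  assumes "g \<in> unitary_group"
  shows "cmod (entry g c i j) \<le> 1"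
proof -
  have "complex_of_real (\<Sum>m\<in>UNIV. (cmod (g $ i $ m))\<^sup>2) = 1"
    using unitary_rows(1)[OF assms, of i i] by (simp only: of_real_sum complex_norm_square) simp
  then have "(\<Sum>m\<in>UNIV. (cmod (g $ i $ m))\<^sup>2) = 1"
    by (rule of_real_eq_1_iff[THEN iffD1])
  then have "(cmod (g $ i $ j))\<^sup>2 \<le> 1"
    using member_le_sum[of j UNIV "\<lambda>m. (cmod (g $ i $ m))\<^sup>2"] by simp
  then have "cmod (g $ i $ j) \<le> 1" by (simp add: power_le_one_iff)
  then show ?thesis by (cases c) (simp_all add: entry_def)
qed

lemma cmod_word_ev_le_1:
  assumes "g \<in> unitary_group"
  shows "cmod (word_ev g w) \<le> 1"
proof -
  have "cmod (\<Prod>(c, i, j)\<leftarrow>l. entry g c i j) \<le> 1" for l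
  proof (induction l)
    case (Cons a l)
    obtain c i j where "a = (c, i, j)" by (cases a)
    then show ?case
      using Cons unitary_entry_le_1[OF assms, of c i j] by (simp add: norm_mult mult_le_one)
  qed simp
  then show ?thesis by (simp add: word_ev_def)
qed

lemma classical_bdd:
  assumes "G \<subseteq> unitary_group"
  shows "bdd_above ((\<lambda>g. cmod (ev g x)) ` G)"
proof (rule bdd_aboveI2)
  fix g assume "g \<in> G"
  then have g: "g \<in> unitary_group" using assms by blast
  have "cmod (ev g x) \<le> (\<Sum>w\<in>Poly_Mapping.keys x. cmod (Poly_Mapping.lookup x w * word_ev g w))"
    unfolding ev_eq linear_ext_def by (rule norm_sum)
  also have "\<dots> \<le> (\<Sum>w\<in>Poly_Mapping.keys x. cmod (Poly_Mapping.lookup x w))"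
    using cmod_word_ev_le_1[OF g] by (intro sum_mono) (simp add: norm_mult mult_left_le)
  finally show "cmod (ev g x) \<le> (\<Sum>w\<in>Poly_Mapping.keys x. cmod (Poly_Mapping.lookup x w))" .
qed

lemma classical_upper: "G \<subseteq> unitary_group \<Longrightarrow> g \<in> G \<Longrightarrow> cmod (ev g x) \<le> classical G x"
  unfolding classical_def by (rule cSUP_upper[OF _ classical_bdd])

lemma classical_least:
  "G \<noteq> {} \<Longrightarrow> (\<And>g. g \<in> G \<Longrightarrow> cmod (ev g x) \<le> c) \<Longrightarrow> classical G x \<le> c"
  unfolding classical_def by (rule cSUP_least)

lemma classical_nonneg:
  assumes "G \<subseteq> unitary_group" "G \<noteq> {}"
  shows "0 \<le> classical G x"
proof -
  obtain g where "g \<in> G" using assms(2) by blast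
  then have "cmod (ev g x) \<le> classical G x" by (rule classical_upper[OF assms(1)])
  then show ?thesis using norm_ge_zero order_trans by blast
qed

lemma classical_eq_0_iff:
  assumes "G \<subseteq> unitary_group" "G \<noteq> {}"
  shows "classical G x = 0 \<longleftrightarrow> (\<forall>g\<in>G. ev g x = 0)"
proof
  assume "classical G x = 0"
  then show "\<forall>g\<in>G. ev g x = 0" using classical_upper[OF assms(1), of _ x] by fastforce
next
  assume "\<forall>g\<in>G. ev g x = 0"
  then have "classical G x \<le> 0" using assms(2) by (intro classical_least) auto
  then show "classical G x = 0" using classical_nonneg[OF assms, of x] by simp
qed

lemma cstar_seminorm_classical:
  assumes sub: "G \<subseteq> unitary_group" and ne: "G \<noteq> {}"
  shows "cstar_seminorm (classical G)"
  unfolding cstar_seminorm_def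
proof (intro conjI allI)
  fix x y :: "'a free_alg" and c :: complex
  note up = classical_upper[OF sub] and nn = classical_nonneg[OF sub ne]
  show "classical G (x + y) \<le> classical G x + classical G y"
    by (rule classical_least[OF ne])
      (simp add: ev_add, rule order_trans[OF norm_triangle_ineq add_mono[OF up up]])
  show "classical G (x * y) \<le> classical G x * classical G y"
    by (rule classical_least[OF ne]) (auto simp: ev_mult norm_mult intro!: mult_mono up nn)
  have scal_le: "classical G (scal c x) \<le> cmod c * classical G x" for c x
    by (rule classical_least[OF ne]) (simp add: ev_scal norm_mult mult_left_mono up)
  show "classical G (scal c x) = cmod c * classical G x"
  proof (cases "c = 0")
    case True
    then show ?thesis using scal_le[of c x] nn[of "scal c x"] by simp
  next
    case False
    have "classical G x \<le> classical G (scal c x) / cmod c"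
    proof (rule classical_least[OF ne])
      fix g assume "g \<in> G"
      then have "cmod c * cmod (ev g x) \<le> classical G (scal c x)"
        using up[of g "scal c x"] by (simp add: ev_scal norm_mult)
      then show "cmod (ev g x) \<le> classical G (scal c x) / cmod c"
        using False by (simp add: field_simps)
    qed
    then show ?thesis using False scal_le[of c x] by (simp add: field_simps)
  qed
  have sq: "cmod (ev g (star x * x)) = (cmod (ev g x))\<^sup>2" for g
    by (simp add: ev_mult ev_star norm_mult power2_eq_square)
  show "classical G (star x * x) = (classical G x)\<^sup>2"
  proof (rule antisym)
    show "classical G (star x * x) \<le> (classical G x)\<^sup>2"
      by (rule classical_least[OF ne]) (simp add: sq power_mono up)
    have "classical G x \<le> sqrt (classical G (star x * x))"
    proof (rule classical_least[OF ne])
      fix g assume "g \<in> G"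
      then show "cmod (ev g x) \<le> sqrt (classical G (star x * x))"
        using up[of g "star x * x"] by (intro real_le_rsqrt) (simp add: sq)
    qed
    then show "(classical G x)\<^sup>2 \<le> classical G (star x * x)"
      using nn[of x] nn[of "star x * x"] by (metis power_mono real_sqrt_pow2)
  qed
qed

lemma biunitary_classical:
  assumes sub: "G \<subseteq> unitary_group" and ne: "G \<noteq> {}"
  shows "biunitary (classical G)"
proof -
  have "(\<Sum>m\<in>UNIV. g $ i $ m * cnj (g $ j $ m)) = (if i = j then 1 else 0)"
    "(\<Sum>m\<in>UNIV. cnj (g $ m $ i) * g $ m $ j) = (if i = j then 1 else 0)"
    "(\<Sum>m\<in>UNIV. g $ m $ i * cnj (g $ m $ j)) = (if i = j then 1 else 0)"
    "(\<Sum>m\<in>UNIV. cnj (g $ i $ m) * g $ j $ m) = (if i = j then 1 else 0)"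
    if "g \<in> G" for g i j
    using that sub unitary_rows[of g i j] unitary_rows[of g j i]
    by (auto simp: mult.commute)
  moreover have "ev g (if P then 1 else 0) = (if P then 1 else 0)" for g :: "complex^'a^'a" and P
    by simp
  ultimately show ?thesis
    by (simp add: biunitary_def classical_eq_0_iff[OF sub ne] ev_diff ev_sum ev_mult entry_def
        split del: if_split)
qed

text \<open>
  Positivity of a contractive unital functional, without the representing measure: if \<open>a\<close> has nonnegative
  real part and modulus at most \<open>M\<close>, then \<open>R - a\<close> has modulus at most \<open>sqrt (R\<^sup>2 + M\<^sup>2)\<close> for every \<open>R > 0\<close>,
  and the bound exceeds \<open>R\<close> by a quantity that tends to 0 as \<open>R\<close> grows.
\<close>

lemma state_nonneg:
  assumes sub: "G \<subseteq> unitary_group" and ne: "G \<noteq> {}"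
    and st: "state (classical G) \<phi>"
    and pos: "\<And>g. g \<in> G \<Longrightarrow> 0 \<le> Re (ev g a)"
  shows "0 \<le> Re (\<phi> a)"
proof (rule ccontr)
  assume "\<not> 0 \<le> Re (\<phi> a)"
  define e where "e = - Re (\<phi> a)"
  have e: "0 < e" using \<open>\<not> 0 \<le> Re (\<phi> a)\<close> by (simp add: e_def)
  define M where "M = classical G a"
  have M: "0 \<le> M" unfolding M_def by (rule classical_nonneg[OF sub ne])
  \<comment> \<open>large enough that \<open>(R + e)\<^sup>2 \<le> R\<^sup>2 + M\<^sup>2\<close> is impossible\<close>
  define R where "R = M\<^sup>2 / e + 1"
  have R: "0 < R" using e by (simp add: R_def add_nonneg_pos)
  define x where "x = scal (of_real R) 1 + scal (-1) a"
  have "\<phi> x = of_real R - \<phi> a"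
    using st by (simp add: state_def x_def)
  then have "R + e \<le> cmod (\<phi> x)"
    using complex_Re_le_cmod[of "\<phi> x"] by (simp add: e_def)
  also have "\<dots> \<le> classical G x" using st by (simp add: state_def)
  also have "\<dots> \<le> sqrt (R\<^sup>2 + M\<^sup>2)"
  proof (rule classical_least[OF ne])
    fix g assume g: "g \<in> G"
    have "(cmod (ev g x))\<^sup>2 = R\<^sup>2 - 2 * R * Re (ev g a) + (cmod (ev g a))\<^sup>2"
      by (simp add: x_def ev_add ev_scal cmod_power2 power2_diff)
    also have "\<dots> \<le> R\<^sup>2 + M\<^sup>2"
    proof -
      have "(cmod (ev g a))\<^sup>2 \<le> M\<^sup>2"
        unfolding M_def by (intro power_mono classical_upper[OF sub g]) simp
      then show ?thesis using R pos[OF g] by (smt (verit) mult_nonneg_nonneg)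
    qed
    finally show "cmod (ev g x) \<le> sqrt (R\<^sup>2 + M\<^sup>2)" by (rule real_le_rsqrt)
  qed
  finally have "(R + e)\<^sup>2 \<le> R\<^sup>2 + M\<^sup>2"
    using R e power_mono[of "R + e" "sqrt (R\<^sup>2 + M\<^sup>2)" 2] by simp
  moreover have "R * e = M\<^sup>2 + e" using e by (simp add: R_def field_simps)
  ultimately have "2 * (M\<^sup>2 + e) + e\<^sup>2 \<le> M\<^sup>2"
    by (simp add: power2_sum)
  then show False using e M by (smt (verit) zero_le_power2)
qed

lemma state_sum:
  assumes "state p \<phi>"
  shows "\<phi> (\<Sum>i\<in>I. scal (c i) (f i)) = (\<Sum>i\<in>I. c i * \<phi> (f i))"
proof -
  have add: "\<phi> (x + y) = \<phi> x + \<phi> y" and sc: "\<phi> (scal c x) = c * \<phi> x" for x y c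
    using assms by (auto simp: state_def)
  have "\<phi> 0 = 0" using add[of 0 0] by simp
  then show ?thesis
    by (induction I rule: infinite_finite_induct) (simp_all add: add sc)
qed

text \<open>
  Slicing with \<open>\<phi>\<close> in the first variable gives an element \<open>b\<close> of the algebra whose value at \<open>h\<close> is \<open>\<phi>\<close> of the
  section of \<open>z\<close> at \<open>h\<close>; the product functional is \<open>\<psi> b\<close>.
\<close>

lemma product_state_nonneg:
  assumes sub: "G \<subseteq> unitary_group" and ne: "G \<noteq> {}"
    and \<phi>: "state (classical G) \<phi>" and \<psi>: "state (classical G) \<psi>"
    and pos: "\<And>g h. g \<in> G \<Longrightarrow> h \<in> G \<Longrightarrow> 0 \<le> Re (ev2 g h z)"
  shows "0 \<le> Re (tensor_functional \<phi> \<psi> z)"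
proof -
  let ?K = "Poly_Mapping.keys z" and ?c = "Poly_Mapping.lookup z"
  define b where "b = (\<Sum>k\<in>?K. scal (?c k * \<phi> (Poly_Mapping.single (fst k) 1))
      (Poly_Mapping.single (snd k) 1))"
  have "0 \<le> Re (ev h b)" if h: "h \<in> G" for h
  proof -
    define a where "a = (\<Sum>k\<in>?K. scal (?c k * word_ev h (snd k)) (Poly_Mapping.single (fst k) 1))"
    have "ev g a = ev2 g h z" for g
      by (simp add: a_def ev_sum ev_scal ev_single ev2_def linear_ext_def case_prod_unfold mult_ac)
    then have "0 \<le> Re (\<phi> a)"
      using pos h by (intro state_nonneg[OF sub ne \<phi>]) simp
    also have "\<phi> a = ev h b"
      by (simp add: a_def b_def state_sum[OF \<phi>] ev_sum ev_scal ev_single mult_ac)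
    finally show ?thesis .
  qed
  then have "0 \<le> Re (\<psi> b)" by (rule state_nonneg[OF sub ne \<psi>])
  also have "\<psi> b = tensor_functional \<phi> \<psi> z"
    by (simp add: b_def state_sum[OF \<psi>] tensor_functional_def case_prod_unfold mult.assoc)
  finally show ?thesis .
qed

lemma tensor_functional_eq:
  "tensor_functional \<phi> \<psi> =
    linear_ext (\<lambda>(v, w). \<phi> (Poly_Mapping.single v 1) * \<psi> (Poly_Mapping.single w 1))"
  by (simp add: fun_eq_iff tensor_functional_def linear_ext_def case_prod_unfold)

lemma closed_quantum_subgroup_classical:
  assumes "unitary_subgroup G"
  shows "closed_quantum_subgroup (classical G)"
proof -
  have sub: "G \<subseteq> unitary_group" and one: "mat 1 \<in> G"
    and mul: "\<And>g h. g \<in> G \<Longrightarrow> h \<in> G \<Longrightarrow> g ** h \<in> G" and adj: "\<And>g. g \<in> G \<Longrightarrow> adj_mat g \<in> G"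
    using assms by (auto simp: unitary_subgroup_def)
  have ne: "G \<noteq> {}" using one by blast
  have "min_tensor_norm_le (classical G) (comult x) (classical G x)" for x
    unfolding min_tensor_norm_le_def
  proof (intro allI impI)
    fix \<phi> \<psi> y
    assume st: "state (classical G) \<phi>" "state (classical G) \<psi>"
    define c where "c = classical G x"
    \<comment> \<open>\<open>y\<^sup>* (c\<^sup>2 - z\<^sup>* z) y\<close> with \<open>z\<close> the comultiplication of \<open>x\<close>, a nonnegative function on \<open>G \<times> G\<close>\<close>
    define f where "f = scal (of_real (c\<^sup>2)) (star2 y * y) - star2 y * star2 (comult x) * comult x * y"
    have "0 \<le> Re (tensor_functional \<phi> \<psi> f)"
    proof (rule product_state_nonneg[OF sub ne st])
      fix g h assume "g \<in> G" "h \<in> G"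
      then have le: "(cmod (ev (g ** h) x))\<^sup>2 \<le> c\<^sup>2"
        unfolding c_def by (intro power_mono classical_upper[OF sub mul]) auto
      have "ev2 g h f = of_real (c\<^sup>2) * (ev2 g h y * cnj (ev2 g h y)) -
          (ev (g ** h) x * cnj (ev (g ** h) x)) * (ev2 g h y * cnj (ev2 g h y))"
        by (simp add: f_def ev2_diff ev2_scal ev2_mult ev2_star2 ev2_comult mult_ac)
      also have "\<dots> = of_real ((c\<^sup>2 - (cmod (ev (g ** h) x))\<^sup>2) * (cmod (ev2 g h y))\<^sup>2)"
        by (simp only: complex_norm_square[symmetric] of_real_mult of_real_diff of_real_power ring_distribs)
      finally show "0 \<le> Re (ev2 g h f)" using le by simp
    qed
    also have "tensor_functional \<phi> \<psi> f = of_real (c\<^sup>2) * tensor_functional \<phi> \<psi> (star2 y * y) -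
        tensor_functional \<phi> \<psi> (star2 y * star2 (comult x) * comult x * y)"
      by (simp only: f_def tensor_functional_eq linear_ext_diff linear_ext_scal)
    finally show "Re (tensor_functional \<phi> \<psi> (star2 y * star2 (comult x) * comult x * y))
        \<le> (classical G x)\<^sup>2 * Re (tensor_functional \<phi> \<psi> (star2 y * y))"
      by (simp add: c_def flip: of_real_power)
  qed
  moreover have "cmod (counit x) \<le> classical G x" for x
    unfolding counit_def by (rule classical_upper[OF sub one])
  moreover have "classical G (antipode x) \<le> classical G x" for x
    by (rule classical_least[OF ne]) (simp add: ev_antipode classical_upper[OF sub adj])
  ultimately show ?thesis
    using cstar_seminorm_classical[OF sub ne] biunitary_classical[OF sub ne]
    by (simp add: closed_quantum_subgroup_def)
qed

lemma classical_mono: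
  assumes "H \<subseteq> G" "H \<noteq> {}" "G \<subseteq> unitary_group"
  shows "quantum_subgroup_of (classical H) (classical G)"
  unfolding quantum_subgroup_of_def
  using assms by (auto intro!: classical_least classical_upper)

section \<open>Tensors invariant under the Lie algebra of complex matrices\<close>

text \<open>
  The complex span of a finite family \<open>v\<close> of functions, indexed by \<open>M\<close>.
\<close>

definition fam_span :: "'m set \<Rightarrow> ('m \<Rightarrow> 'w \<Rightarrow> complex) \<Rightarrow> ('w \<Rightarrow> complex) set" where
  "fam_span M v = {t. \<exists>a. \<forall>w. t w = (\<Sum>m\<in>M. a m * v m w)}"

lemma fam_spanI: "(\<And>w. t w = (\<Sum>m\<in>M. a m * v m w)) \<Longrightarrow> t \<in> fam_span M v"
  unfolding fam_span_def by blast

lemma fam_span_zero: "(\<lambda>w. 0) \<in> fam_span M v"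
  by (rule fam_spanI[where a = "\<lambda>_. 0"]) simp

lemma fam_span_scaled_member:
  assumes "finite M" "m \<in> M"
  shows "(\<lambda>w. c * v m w) \<in> fam_span M v"
proof (rule fam_spanI)
  fix w
  have "(\<Sum>i\<in>M. (if i = m then c else 0) * v i w) = (\<Sum>i\<in>M. if i = m then c * v i w else 0)"
    by (intro sum.cong) auto
  then show "c * v m w = (\<Sum>i\<in>M. (if i = m then c else 0) * v i w)"
    using assms by simp
qed

lemma fam_span_add:
  assumes "s \<in> fam_span M v" "t \<in> fam_span M v"
  shows "(\<lambda>w. s w + t w) \<in> fam_span M v"
proof -
  obtain a b where "\<And>w. s w = (\<Sum>m\<in>M. a m * v m w)" "\<And>w. t w = (\<Sum>m\<in>M. b m * v m w)"
    using assms unfolding fam_span_def by blast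
  then show ?thesis
    by (intro fam_spanI[where a = "\<lambda>m. a m + b m"]) (simp add: sum.distrib ring_distribs)
qed

lemma fam_span_sum:
  assumes "\<And>i. i \<in> I \<Longrightarrow> s i \<in> fam_span M v"
  shows "(\<lambda>w. \<Sum>i\<in>I. s i w) \<in> fam_span M v"
  using assms
proof (induction I rule: infinite_finite_induct)
  case (insert x F)
  then show ?case using fam_span_add[of "s x" M v "\<lambda>w. \<Sum>i\<in>F. s i w"] by simp
qed (simp_all add: fam_span_zero)

text \<open>
  Orthogonal projection onto the span of the family, for the scalar product given by summation over
  \<open>\<Omega>\<close>. The family need not be linearly independent; the tensors of matchings are dependent when \<open>N\<close> is
  smaller than the number of pairs.
\<close>

lemma orthogonal_decomposition:
  fixes v :: "'m \<Rightarrow> 'w \<Rightarrow> complex"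
  assumes "finite M" "finite \<Omega>"
  shows "\<exists>a. \<forall>m\<in>M. (\<Sum>w\<in>\<Omega>. (t w - (\<Sum>i\<in>M. a i * v i w)) * cnj (v m w)) = 0"
  using assms(1)
proof (induction M arbitrary: t)
  case empty
  then show ?case by simp
next
  case (insert x M)
  define ip where "ip f g = (\<Sum>w\<in>\<Omega>. f w * cnj (g w))" for f g :: "'w \<Rightarrow> complex"
  obtain a where a: "\<forall>m\<in>M. (\<Sum>w\<in>\<Omega>. (t w - (\<Sum>i\<in>M. a i * v i w)) * cnj (v m w)) = 0"
    using insert.IH[of t] by blast
  obtain b where b: "\<forall>m\<in>M. (\<Sum>w\<in>\<Omega>. (v x w - (\<Sum>i\<in>M. b i * v i w)) * cnj (v m w)) = 0"
    using insert.IH[of "v x"] by blast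
  define r where "r = (\<lambda>w. t w - (\<Sum>i\<in>M. a i * v i w))"
  define u where "u = (\<lambda>w. v x w - (\<Sum>i\<in>M. b i * v i w))"
  define c where "c = ip r u / ip u u"
  have ipr: "ip r (v m) = 0" and ipu: "ip u (v m) = 0" if "m \<in> M" for m
    using a b that by (auto simp: ip_def r_def u_def)
  have ip_lin: "ip (\<lambda>w. f w - k * g w) h = ip f h - k * ip g h" for f g h k
    by (simp add: ip_def ring_distribs sum_subtractf sum_distrib_left mult.assoc)
  \<comment> \<open>If \<open>u\<close> vanishes on \<open>\<Omega>\<close>, then \<open>c = 0\<close> by division by zero, and \<open>ip r u = 0\<close> as well.\<close>
  have cu: "ip r u - c * ip u u = 0"
  proof (cases "ip u u = 0")
    case True
    have "ip u u = of_real (\<Sum>w\<in>\<Omega>. (cmod (u w))\<^sup>2)"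
      by (simp add: ip_def complex_norm_square del: of_real_power)
    with True have "(\<Sum>w\<in>\<Omega>. (cmod (u w))\<^sup>2) = 0" by (simp only: of_real_eq_0_iff)
    then have "\<forall>w\<in>\<Omega>. u w = 0" using assms(2) by (simp add: sum_nonneg_eq_0_iff)
    then have "ip r u = 0" by (simp add: ip_def)
    with True show ?thesis by simp
  qed (simp add: c_def)
  define r' where "r' = (\<lambda>w. r w - c * u w)"
  have r'M: "ip r' (v m) = 0" if "m \<in> M" for m
    using ip_lin[of r c u "v m"] ipr[OF that] ipu[OF that] by (simp add: r'_def)
  have "ip r' u = 0" using ip_lin[of r c u u] cu by (simp add: r'_def)
  moreover have "ip r' u = ip r' (v x) - (\<Sum>i\<in>M. cnj (b i) * ip r' (v i))"
  proof -
    have "ip r' u = (\<Sum>w\<in>\<Omega>. r' w * cnj (v x w)) - (\<Sum>w\<in>\<Omega>. \<Sum>i\<in>M. cnj (b i) * (r' w * cnj (v i w)))"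
      by (simp add: ip_def u_def ring_distribs sum_subtractf sum_distrib_left mult_ac)
    also have "(\<Sum>w\<in>\<Omega>. \<Sum>i\<in>M. cnj (b i) * (r' w * cnj (v i w))) = (\<Sum>i\<in>M. cnj (b i) * ip r' (v i))"
      by (subst sum.swap) (simp add: ip_def sum_distrib_left)
    finally show ?thesis by (simp add: ip_def)
  qed
  ultimately have r'x: "ip r' (v x) = 0" using r'M by simp
  define a' where "a' = (\<lambda>m. a m - c * b m)(x := c)"
  have "t w - (\<Sum>i\<in>insert x M. a' i * v i w) = r' w" for w
  proof -
    have "(\<Sum>i\<in>M. a' i * v i w) = (\<Sum>i\<in>M. (a i - c * b i) * v i w)"
      using insert.hyps(2) by (intro sum.cong) (auto simp: a'_def)
    also have "\<dots> = (\<Sum>i\<in>M. a i * v i w) - c * (\<Sum>i\<in>M. b i * v i w)"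
      by (simp add: ring_distribs sum_subtractf sum_distrib_left mult.assoc)
    finally show ?thesis
      using insert.hyps by (simp add: r'_def r_def u_def a'_def algebra_simps)
  qed
  then show ?case
    using r'x r'M by (intro exI[of _ a']) (auto simp: ip_def)
qed

text \<open>
  The tensor of a partition \<open>\<pi>\<close>. A tensor is a function of words \<open>w\<close>, which are total functions from positions
  to indices; only the values at finitely many positions matter.
\<close>

definition block_const :: "'p set set \<Rightarrow> ('p \<Rightarrow> 'n) \<Rightarrow> complex" where
  "block_const \<pi> w = (if \<forall>B\<in>\<pi>. \<forall>x\<in>B. \<forall>y\<in>B. w x = w y then 1 else 0)"

lemma block_const_cong:
  assumes "partition_on P \<pi>" "\<And>q. q \<in> P \<Longrightarrow> w q = w' q"
  shows "block_const \<pi> w = block_const \<pi> w'"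
proof -
  have "\<forall>B\<in>\<pi>. \<forall>q\<in>B. w q = w' q"
    using assms unfolding partition_on_def by blast
  then have "(\<forall>x\<in>B. \<forall>y\<in>B. w x = w y) \<longleftrightarrow> (\<forall>x\<in>B. \<forall>y\<in>B. w' x = w' y)" if "B \<in> \<pi>" for B
    using that by metis
  then show ?thesis by (simp add: block_const_def)
qed

text \<open>
  The partitions that pair every position in \<open>pos\<close> with one in \<open>neg\<close>.
\<close>

definition matchings :: "'p set \<Rightarrow> 'p set \<Rightarrow> 'p set set set" where
  "matchings pos neg =
     {\<pi>. partition_on (pos \<union> neg) \<pi> \<and> (\<forall>B\<in>\<pi>. \<exists>p\<in>pos. \<exists>n\<in>neg. B = {p, n})}"

lemma finite_matchings:
  assumes "finite pos" "finite neg"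
  shows "finite (matchings pos neg)"
proof (rule finite_subset)
  show "matchings pos neg \<subseteq> Pow (Pow (pos \<union> neg))"
    by (auto simp: matchings_def partition_on_def)
qed (use assms in simp)

lemma insert_matching:
  assumes "\<pi> \<in> matchings (pos - {p}) (neg - {n})" "p \<in> pos" "n \<in> neg" "pos \<inter> neg = {}"
  shows "insert {p, n} \<pi> \<in> matchings pos neg"
proof -
  have \<pi>: "partition_on ((pos - {p}) \<union> (neg - {n})) \<pi>"
    and bl: "\<forall>B\<in>\<pi>. \<exists>p'\<in>pos - {p}. \<exists>n'\<in>neg - {n}. B = {p', n'}"
    using assms(1) by (auto simp: matchings_def)
  have eq: "(pos - {p}) \<union> (neg - {n}) = (pos \<union> neg) - {p, n}" using assms by blast
  have "disjnt {p, n} (\<Union>\<pi>)"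
    using partition_onD1[OF \<pi>] assms by (auto simp: disjnt_def)
  then have "partition_on (pos \<union> neg) (insert {p, n} \<pi>)"
    using \<pi> assms(2,3) unfolding eq by (subst partition_on_insert) auto
  then show ?thesis using bl assms(2,3) unfolding matchings_def by (simp, blast)
qed

lemma block_const_insert_pair:
  "block_const (insert {p, n} \<pi>) w = (if w p = w n then block_const \<pi> w else 0)"
  by (auto simp: block_const_def)

text \<open>
  Invariance under the Lie algebra of all complex matrices, which acts by its standard representation at
  the positions in \<open>pos\<close> and by the dual representation at those in \<open>neg\<close>. The elementary matrix \<open>E_ab\<close>
  acts by the left side minus the right side.
\<close>

definition gl_invariant :: "'p set \<Rightarrow> 'p set \<Rightarrow> (('p \<Rightarrow> 'n) \<Rightarrow> complex) \<Rightarrow> bool" where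
  "gl_invariant pos neg t \<longleftrightarrow> (\<forall>a b w.
     (\<Sum>p\<in>pos. if w p = a then t (w(p := b)) else 0) =
     (\<Sum>n\<in>neg. if w n = b then t (w(n := a)) else 0))"

lemma gl_invariant_block_const:
  assumes "\<pi> \<in> matchings pos neg" "pos \<inter> neg = {}"
  shows "gl_invariant pos neg (block_const \<pi>)"
  unfolding gl_invariant_def
proof (intro allI)
  fix a b :: 'n and w
  have part: "partition_on (pos \<union> neg) \<pi>"
    and bl: "\<forall>B\<in>\<pi>. \<exists>p n. p \<in> pos \<and> n \<in> neg \<and> B = {p, n}"
    using assms(1) unfolding matchings_def by (simp, blast)
  obtain P N where PN: "\<And>B. B \<in> \<pi> \<Longrightarrow> P B \<in> pos" "\<And>B. B \<in> \<pi> \<Longrightarrow> N B \<in> neg"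
      "\<And>B. B \<in> \<pi> \<Longrightarrow> B = {P B, N B}"
    using bl by metis
  have disj: "B = B'" if "B \<in> \<pi>" "B' \<in> \<pi>" "x \<in> B" "x \<in> B'" for B B' x
    using part that unfolding partition_on_def disjoint_def by blast
  have cover: "\<exists>B\<in>\<pi>. x \<in> B" if "x \<in> pos \<union> neg" for x
    using part that unfolding partition_on_def by blast
  have bijP: "bij_betw P \<pi> pos"
  proof (rule bij_betw_imageI)
    show "inj_on P \<pi>" by (rule inj_onI) (metis PN(3) disj insertI1)
    show "P ` \<pi> = pos"
    proof
      show "pos \<subseteq> P ` \<pi>"
      proof
        fix x assume x: "x \<in> pos"
        then obtain B where B: "B \<in> \<pi>" "x \<in> B" using cover by blast
        then have "x = P B \<or> x = N B" using PN(3)[of B] by auto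
        then show "x \<in> P ` \<pi>" using B x PN(2)[of B] assms(2) by blast
      qed
    qed (use PN(1) in blast)
  qed
  have bijN: "bij_betw N \<pi> neg"
  proof (rule bij_betw_imageI)
    show "inj_on N \<pi>" by (rule inj_onI) (metis PN(3) disj insertI1 insert_commute)
    show "N ` \<pi> = neg"
    proof
      show "neg \<subseteq> N ` \<pi>"
      proof
        fix x assume x: "x \<in> neg"
        then obtain B where B: "B \<in> \<pi>" "x \<in> B" using cover by blast
        then have "x = P B \<or> x = N B" using PN(3)[of B] by auto
        then show "x \<in> N ` \<pi>" using B x PN(1)[of B] assms(2) by blast
      qed
    qed (use PN(2) in blast)
  qed
  have const: "block_const \<pi> w' = (if \<forall>B\<in>\<pi>. w' (P B) = w' (N B) then 1 else 0)"
    for w' :: "'a \<Rightarrow> 'n"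
  proof -
    have "(\<forall>x\<in>B. \<forall>y\<in>B. w' x = w' y) \<longleftrightarrow> w' (P B) = w' (N B)" if "B \<in> \<pi>" for B
      by (subst PN(3)[OF that], subst PN(3)[OF that]) auto
    then show ?thesis by (simp add: block_const_def)
  qed
  have neq: "P B \<noteq> N B'" if "B \<in> \<pi>" "B' \<in> \<pi>" for B B'
    using PN that assms(2) by (metis disjoint_iff)
  have injs: "P B = P B' \<longleftrightarrow> B = B'" "N B = N B' \<longleftrightarrow> B = B'" if "B \<in> \<pi>" "B' \<in> \<pi>" for B B'
    using bijP bijN that by (auto simp: bij_betw_def inj_on_def)
  have term_eq: "(if w (P B) = a then block_const \<pi> (w(P B := b)) else 0) =
      (if w (N B) = b then block_const \<pi> (w(N B := a)) else 0)" if B: "B \<in> \<pi>" for B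
  proof -
    have "(\<forall>B'\<in>\<pi>. (w(P B := b)) (P B') = (w(P B := b)) (N B')) \<longleftrightarrow>
        w (N B) = b \<and> (\<forall>B'\<in>\<pi> - {B}. w (P B') = w (N B'))"
    proof -
      have "(w(P B := b)) (P B') = (if B' = B then b else w (P B'))"
        "(w(P B := b)) (N B') = w (N B')" if "B' \<in> \<pi>" for B'
        using neq[OF B that] injs(1)[OF B that] by auto
      then show ?thesis using B by auto
    qed
    moreover have "(\<forall>B'\<in>\<pi>. (w(N B := a)) (P B') = (w(N B := a)) (N B')) \<longleftrightarrow>
        w (P B) = a \<and> (\<forall>B'\<in>\<pi> - {B}. w (P B') = w (N B'))"
    proof -
      have "(w(N B := a)) (N B') = (if B' = B then a else w (N B'))"
        "(w(N B := a)) (P B') = w (P B')" if "B' \<in> \<pi>" for B'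
        using neq[OF that B] injs(2)[OF B that] by auto
      then show ?thesis using B by auto
    qed
    ultimately have "(w (P B) = a \<and> (\<forall>B'\<in>\<pi>. (w(P B := b)) (P B') = (w(P B := b)) (N B'))) \<longleftrightarrow>
        (w (N B) = b \<and> (\<forall>B'\<in>\<pi>. (w(N B := a)) (P B') = (w(N B := a)) (N B')))"
      by blast
    moreover have "(if x then if y then 1 else 0 else 0) = (if x \<and> y then 1 else (0 :: complex))" for x y
      by simp
    ultimately show ?thesis by (simp only: const)
  qed
  have "(\<Sum>p\<in>pos. if w p = a then block_const \<pi> (w(p := b)) else 0) =
      (\<Sum>B\<in>\<pi>. if w (P B) = a then block_const \<pi> (w(P B := b)) else 0)"
    by (rule sum.reindex_bij_betw[OF bijP, symmetric])
  also have "\<dots> = (\<Sum>B\<in>\<pi>. if w (N B) = b then block_const \<pi> (w(N B := a)) else 0)"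
    by (rule sum.cong[OF refl]) (erule term_eq)
  also have "\<dots> = (\<Sum>n\<in>neg. if w n = b then block_const \<pi> (w(n := a)) else 0)"
    by (rule sum.reindex_bij_betw[OF bijN])
  finally show "(\<Sum>p\<in>pos. if w p = a then block_const \<pi> (w(p := b)) else 0) =
      (\<Sum>n\<in>neg. if w n = b then block_const \<pi> (w(n := a)) else 0)" .
qed

text \<open>
  On the tensor factor at position \<open>q\<close>, the elementary matrices \<open>E_ab\<close> and \<open>E_ba\<close> are adjoint to each other.
\<close>

lemma sum_PiE_move:
  fixes f g :: "('p \<Rightarrow> 'n::finite) \<Rightarrow> complex"
  assumes "q \<in> P" "finite P"
  shows "(\<Sum>w\<in>P \<rightarrow>\<^sub>E UNIV. if w q = b then f (w(q := a)) * g w else 0) =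
    (\<Sum>w\<in>P \<rightarrow>\<^sub>E UNIV. if w q = a then f w * g (w(q := b)) else 0)"
proof -
  have fin: "finite (P \<rightarrow>\<^sub>E (UNIV :: 'n set))" using assms(2) by (simp add: finite_PiE)
  have upd: "w(q := c) \<in> P \<rightarrow>\<^sub>E UNIV" if "w \<in> P \<rightarrow>\<^sub>E UNIV" for w :: "'p \<Rightarrow> 'n" and c
    using that assms(1) by (auto simp: PiE_iff extensional_def)
  have "(\<Sum>w\<in>P \<rightarrow>\<^sub>E UNIV. if w q = b then f (w(q := a)) * g w else 0) =
      (\<Sum>w\<in>{w \<in> P \<rightarrow>\<^sub>E UNIV. w q = b}. f (w(q := a)) * g w)"
    using fin by (simp add: sum.inter_filter)
  also have "\<dots> = (\<Sum>w\<in>{w \<in> P \<rightarrow>\<^sub>E UNIV. w q = a}. f w * g (w(q := b)))"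
    by (rule sum.reindex_bij_witness[of _ "\<lambda>w. w(q := b)" "\<lambda>w. w(q := a)"])
      (simp_all add: upd fun_upd_idem)
  also have "\<dots> = (\<Sum>w\<in>P \<rightarrow>\<^sub>E UNIV. if w q = a then f w * g (w(q := b)) else 0)"
    using fin by (simp add: sum.inter_filter)
  finally show ?thesis .
qed

text \<open>
  Contraction of the positions \<open>p\<close> and \<open>n\<close>. The result is again a function of total words, but it does not
  depend on the values at \<open>p\<close> and \<open>n\<close>.
\<close>

definition partial_trace :: "'p \<Rightarrow> 'p \<Rightarrow> (('p \<Rightarrow> 'n::finite) \<Rightarrow> complex) \<Rightarrow> ('p \<Rightarrow> 'n) \<Rightarrow> complex" where
  "partial_trace p n t w = (\<Sum>c\<in>UNIV. t (w(p := c, n := c)))"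

lemma gl_invariant_partial_trace:
  fixes t :: "('p \<Rightarrow> 'n::finite) \<Rightarrow> complex"
  assumes inv: "gl_invariant pos neg t"
    and fin: "finite pos" "finite neg" and disj: "pos \<inter> neg = {}"
    and p: "p \<in> pos" and n: "n \<in> neg"
  shows "gl_invariant (pos - {p}) (neg - {n}) (partial_trace p n t)"
  unfolding gl_invariant_def
proof (intro allI)
  fix a b :: 'n and w :: "'p \<Rightarrow> 'n"
  have pn: "p \<noteq> n" using p n disj by blast
  define W where "W c = w(p := c, n := c)" for c
  define X where "X = t (w(p := b, n := a))"
  have L: "(\<Sum>q\<in>pos. if W c q = a then t ((W c)(q := b)) else 0) =
      (if c = a then X else 0) + (\<Sum>q\<in>pos - {p}. if w q = a then t ((w(q := b))(p := c, n := c)) else 0)" for c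
  proof -
    have "(\<Sum>q\<in>pos. if W c q = a then t ((W c)(q := b)) else 0) =
        (if c = a then t ((W c)(p := b)) else 0) + (\<Sum>q\<in>pos - {p}. if W c q = a then t ((W c)(q := b)) else 0)"
      using fin p pn by (subst sum.remove[of _ p]) (auto simp: W_def)
    moreover have "(\<Sum>q\<in>pos - {p}. if W c q = a then t ((W c)(q := b)) else 0) =
        (\<Sum>q\<in>pos - {p}. if w q = a then t ((w(q := b))(p := c, n := c)) else 0)"
    proof (rule sum.cong[OF refl])
      fix q assume "q \<in> pos - {p}"
      then have "q \<noteq> p" "q \<noteq> n" using n disj by auto
      then show "(if W c q = a then t ((W c)(q := b)) else 0) =
          (if w q = a then t ((w(q := b))(p := c, n := c)) else 0)"
        by (simp add: W_def fun_upd_twist)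
    qed
    moreover have "(if c = a then t ((W c)(p := b)) else 0) = (if c = a then X else 0)"
      using pn by (auto simp: W_def X_def fun_upd_twist)
    ultimately show ?thesis by simp
  qed
  have R: "(\<Sum>q\<in>neg. if W c q = b then t ((W c)(q := a)) else 0) =
      (if c = b then X else 0) + (\<Sum>q\<in>neg - {n}. if w q = b then t ((w(q := a))(p := c, n := c)) else 0)" for c
  proof -
    have "(\<Sum>q\<in>neg. if W c q = b then t ((W c)(q := a)) else 0) =
        (if c = b then t ((W c)(n := a)) else 0) + (\<Sum>q\<in>neg - {n}. if W c q = b then t ((W c)(q := a)) else 0)"
      using fin n by (subst sum.remove[of _ n]) (auto simp: W_def)
    moreover have "(\<Sum>q\<in>neg - {n}. if W c q = b then t ((W c)(q := a)) else 0) =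
        (\<Sum>q\<in>neg - {n}. if w q = b then t ((w(q := a))(p := c, n := c)) else 0)"
    proof (rule sum.cong[OF refl])
      fix q assume "q \<in> neg - {n}"
      then have "q \<noteq> p" "q \<noteq> n" using p disj by auto
      then show "(if W c q = b then t ((W c)(q := a)) else 0) =
          (if w q = b then t ((w(q := a))(p := c, n := c)) else 0)"
        by (simp add: W_def fun_upd_twist)
    qed
    moreover have "(if c = b then t ((W c)(n := a)) else 0) = (if c = b then X else 0)"
      using pn by (auto simp: W_def X_def)
    ultimately show ?thesis by simp
  qed
  have "(\<Sum>c\<in>UNIV. \<Sum>q\<in>pos. if W c q = a then t ((W c)(q := b)) else 0) =
      (\<Sum>c\<in>UNIV. \<Sum>q\<in>neg. if W c q = b then t ((W c)(q := a)) else 0)"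
    using inv unfolding gl_invariant_def by metis
  then have "(\<Sum>c\<in>UNIV. \<Sum>q\<in>pos - {p}. if w q = a then t ((w(q := b))(p := c, n := c)) else 0) =
      (\<Sum>c\<in>UNIV. \<Sum>q\<in>neg - {n}. if w q = b then t ((w(q := a))(p := c, n := c)) else 0)"
    by (simp add: L R sum.distrib)
  moreover have "(\<Sum>c\<in>UNIV. \<Sum>q\<in>Q. if w q = d then t ((w(q := e))(p := c, n := c)) else 0) =
      (\<Sum>q\<in>Q. if w q = d then partial_trace p n t (w(q := e)) else 0)" for Q d e
    by (subst sum.swap) (auto intro!: sum.cong simp: partial_trace_def)
  ultimately show "(\<Sum>q\<in>pos - {p}. if w q = a then partial_trace p n t (w(q := b)) else 0) =
      (\<Sum>q\<in>neg - {n}. if w q = b then partial_trace p n t (w(q := a)) else 0)"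
    by simp
qed

text \<open>
  The first fundamental theorem for the general linear group, in its infinitesimal form. The sizes of \<open>pos\<close>
  and \<open>neg\<close> may differ; there are then no matchings and \<open>t\<close> vanishes.
\<close>

theorem gl_invariant_in_span_matchings:
  fixes t :: "('p \<Rightarrow> 'n::finite) \<Rightarrow> complex"
  assumes "finite pos" "finite neg" "pos \<inter> neg = {}"
    and "\<And>w w'. (\<And>q. q \<in> pos \<union> neg \<Longrightarrow> w q = w' q) \<Longrightarrow> t w = t w'"
    and "gl_invariant pos neg t"
  shows "t \<in> fam_span (matchings pos neg) block_const"
  using assms
proof (induction "card neg" arbitrary: pos neg t)
  case 0
  have neg: "neg = {}" using 0(1,3) by simp
  show ?case
  proof (cases "pos = {}")
    case True
    have "matchings pos neg = {{}}"
      using True neg by (auto simp: matchings_def partition_on_def)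
    moreover have "t w = t undefined" for w
      by (rule 0(5)) (simp add: True neg)
    ultimately show ?thesis
      by (intro fam_spanI[where a = "\<lambda>_. t undefined"]) (simp add: block_const_def)
  next
    case False
    have "t w = 0" for w
    proof -
      \<comment> \<open>the identity matrix acts on the left by \<open>card pos\<close> and on the right by \<open>0\<close>\<close>
      have "of_nat (card pos) * t w = (\<Sum>p\<in>pos. \<Sum>a\<in>UNIV. if w p = a then t (w(p := a)) else 0)"
        by simp
      also have "\<dots> = (\<Sum>a\<in>UNIV. \<Sum>p\<in>pos. if w p = a then t (w(p := a)) else 0)"
        by (rule sum.swap)
      also have "\<dots> = 0"
        using 0(6) neg unfolding gl_invariant_def by simp
      finally show ?thesis using False 0(2) by simp
    qed
    then have "t = (\<lambda>w. 0)" by blast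
    then show ?thesis by (simp add: fam_span_zero)
  qed
next
  case (Suc k)
  note fin = Suc.prems(1,2) and disj = Suc.prems(3) and loc = Suc.prems(4) and inv = Suc.prems(5)
  define P where "P = pos \<union> neg"
  define \<Omega> where "\<Omega> = P \<rightarrow>\<^sub>E (UNIV :: 'n set)"
  define M where "M = matchings pos neg"
  have finP: "finite P" using fin by (simp add: P_def)
  then have fin\<Omega>: "finite \<Omega>" by (simp add: \<Omega>_def finite_PiE)
  have finM: "finite M" using fin by (simp add: M_def finite_matchings)
  obtain c where c: "\<forall>m\<in>M. (\<Sum>w\<in>\<Omega>. (t w - (\<Sum>i\<in>M. c i * block_const i w)) * cnj (block_const m w)) = 0"
    using orthogonal_decomposition[OF finM fin\<Omega>, of t block_const] by blast
  define r where "r = (\<lambda>w. t w - (\<Sum>i\<in>M. c i * block_const i w))"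
  have r_orth: "(\<Sum>w\<in>\<Omega>. s w * cnj (r w)) = 0" if s: "s \<in> fam_span M block_const" for s
  proof -
    obtain d where d: "\<And>w. s w = (\<Sum>m\<in>M. d m * block_const m w)"
      using s unfolding fam_span_def by blast
    have "(\<Sum>w\<in>\<Omega>. s w * cnj (r w)) = (\<Sum>m\<in>M. \<Sum>w\<in>\<Omega>. d m * (block_const m w * cnj (r w)))"
      by (subst sum.swap) (simp add: d sum_distrib_right mult.assoc)
    also have "\<dots> = (\<Sum>m\<in>M. d m * cnj (\<Sum>w\<in>\<Omega>. r w * cnj (block_const m w)))"
      by (simp add: sum_distrib_left mult.commute)
    also have "\<dots> = 0" using c by (simp add: r_def)
    finally show ?thesis .
  qed
  have r_loc: "r w = r w'" if "\<And>q. q \<in> P \<Longrightarrow> w q = w' q" for w w'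
  proof -
    have "block_const m w = block_const m w'" if "m \<in> M" for m
    proof (rule block_const_cong)
      show "partition_on (pos \<union> neg) m" using \<open>m \<in> M\<close> by (simp add: M_def matchings_def)
      show "w q = w' q" if "q \<in> pos \<union> neg" for q
        using \<open>\<And>q. q \<in> P \<Longrightarrow> w q = w' q\<close> that by (simp only: P_def)
    qed
    moreover have "t w = t w'" by (rule loc) (use that in \<open>simp add: P_def\<close>)
    ultimately show ?thesis by (simp add: r_def)
  qed
  have r_inv: "gl_invariant pos neg r"
    unfolding gl_invariant_def
  proof (intro allI)
    fix a b :: 'n and w :: "'p \<Rightarrow> 'n"
    have *: "(\<Sum>p\<in>Q. if w p = d then r (w(p := e)) else 0) =
        (\<Sum>p\<in>Q. if w p = d then t (w(p := e)) else 0) -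
        (\<Sum>m\<in>M. c m * (\<Sum>p\<in>Q. if w p = d then block_const m (w(p := e)) else 0))" for Q d e
    proof -
      have "(\<Sum>m\<in>M. c m * (\<Sum>p\<in>Q. if w p = d then block_const m (w(p := e)) else 0)) =
          (\<Sum>p\<in>Q. \<Sum>m\<in>M. if w p = d then c m * block_const m (w(p := e)) else 0)"
        by (subst sum.swap) (auto simp: sum_distrib_left intro!: sum.cong)
      also have "\<dots> = (\<Sum>p\<in>Q. if w p = d then (\<Sum>m\<in>M. c m * block_const m (w(p := e))) else 0)"
        by (intro sum.cong) auto
      finally show ?thesis
        by (simp only: sum_subtractf[symmetric]) (auto simp: r_def intro!: sum.cong)
    qed
    have "(\<Sum>p\<in>pos. if w p = a then block_const m (w(p := b)) else 0) =
        (\<Sum>n\<in>neg. if w n = b then block_const m (w(n := a)) else 0)" if "m \<in> M" for m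
    proof -
      have "gl_invariant pos neg (block_const m :: ('p \<Rightarrow> 'n) \<Rightarrow> complex)"
        using that disj unfolding M_def by (rule gl_invariant_block_const)
      then show ?thesis unfolding gl_invariant_def by blast
    qed
    then show "(\<Sum>p\<in>pos. if w p = a then r (w(p := b)) else 0) =
        (\<Sum>n\<in>neg. if w n = b then r (w(n := a)) else 0)"
      using inv unfolding * gl_invariant_def by simp
  qed
  \<comment> \<open>\<open>R a b\<close> is an elementary matrix acting on the \<open>neg\<close> positions, with adjoint \<open>R b a\<close>; \<open>Z\<close> is the Casimir sum.\<close>
  define R where "R a b h w = (\<Sum>n\<in>neg. if w n = b then h (w(n := a)) else 0)"
    for a b :: 'n and h :: "('p \<Rightarrow> 'n) \<Rightarrow> complex" and w
  have R_eq: "R a b r w = (\<Sum>p\<in>pos. if w p = a then r (w(p := b)) else 0)" for a b w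
    using r_inv unfolding gl_invariant_def R_def by simp
  define Z where "Z = (\<lambda>w. \<Sum>a\<in>UNIV. \<Sum>b\<in>UNIV. R b a (R a b r) w)"
  have R_adj: "(\<Sum>w\<in>\<Omega>. R a b f w * cnj (g w)) = (\<Sum>w\<in>\<Omega>. f w * cnj (R b a g w))" for a b f g
  proof -
    have "(\<Sum>w\<in>\<Omega>. R a b f w * cnj (g w)) =
        (\<Sum>n\<in>neg. \<Sum>w\<in>\<Omega>. if w n = b then f (w(n := a)) * cnj (g w) else 0)"
      by (subst sum.swap) (auto simp: R_def sum_distrib_right intro!: sum.cong)
    also have "\<dots> = (\<Sum>n\<in>neg. \<Sum>w\<in>\<Omega>. if w n = a then f w * cnj (g (w(n := b))) else 0)"
      unfolding \<Omega>_def
      by (rule sum.cong[OF refl], rule sum_PiE_move) (use finP in \<open>auto simp: P_def\<close>)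
    also have "\<dots> = (\<Sum>w\<in>\<Omega>. f w * cnj (R b a g w))"
      by (subst sum.swap) (auto simp: R_def sum_distrib_left intro!: sum.cong)
    finally show ?thesis .
  qed
  \<comment> \<open>Invariance moves the inner operator to the \<open>pos\<close> positions, and the sum over \<open>b\<close> becomes a partial trace.\<close>
  have Z_eq: "Z w = (\<Sum>n\<in>neg. \<Sum>p\<in>pos. if w p = w n then partial_trace p n r w else 0)" for w
  proof -
    have "Z w = (\<Sum>b\<in>UNIV. \<Sum>n\<in>neg. \<Sum>a\<in>UNIV. if w n = a then R a b r (w(n := b)) else 0)"
      unfolding Z_def by (subst sum.swap, subst (2) sum.swap) (simp add: R_def)
    also have "\<dots> = (\<Sum>b\<in>UNIV. \<Sum>n\<in>neg. R (w n) b r (w(n := b)))"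
      by simp
    also have "\<dots> = (\<Sum>b\<in>UNIV. \<Sum>n\<in>neg. \<Sum>p\<in>pos. if w p = w n then r (w(p := b, n := b)) else 0)"
    proof (intro sum.cong refl)
      fix b n assume n: "n \<in> neg"
      have "R (w n) b r (w(n := b)) =
          (\<Sum>p\<in>pos. if (w(n := b)) p = w n then r ((w(n := b))(p := b)) else 0)"
        by (rule R_eq)
      also have "\<dots> = (\<Sum>p\<in>pos. if w p = w n then r (w(p := b, n := b)) else 0)"
      proof (intro sum.cong refl)
        fix p assume "p \<in> pos"
        then have "p \<noteq> n" using n disj by blast
        then show "(if (w(n := b)) p = w n then r ((w(n := b))(p := b)) else 0) =
            (if w p = w n then r (w(p := b, n := b)) else 0)"
          by (simp add: fun_upd_twist)
      qed
      finally show "R (w n) b r (w(n := b)) =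
          (\<Sum>p\<in>pos. if w p = w n then r (w(p := b, n := b)) else 0)" .
    qed
    also have "\<dots> = (\<Sum>n\<in>neg. \<Sum>p\<in>pos. \<Sum>b\<in>UNIV. if w p = w n then r (w(p := b, n := b)) else 0)"
      by (subst sum.swap, subst (2) sum.swap) simp
    also have "\<dots> = (\<Sum>n\<in>neg. \<Sum>p\<in>pos. if w p = w n then partial_trace p n r w else 0)"
      by (intro sum.cong refl) (simp add: partial_trace_def)
    finally show ?thesis .
  qed
  have "Z \<in> fam_span M block_const"
  proof -
    have "(\<lambda>w. if w p = w n then partial_trace p n r w else 0) \<in> fam_span M block_const"
      if p: "p \<in> pos" and n: "n \<in> neg" for p n
    proof -
      have "partial_trace p n r \<in> fam_span (matchings (pos - {p}) (neg - {n})) block_const"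
      proof (rule Suc.hyps(1))
        show "k = card (neg - {n})" using Suc.hyps(2) n fin by simp
        show "gl_invariant (pos - {p}) (neg - {n}) (partial_trace p n r)"
          by (rule gl_invariant_partial_trace[OF r_inv fin disj p n])
        show "partial_trace p n r w = partial_trace p n r w'"
          if "\<And>q. q \<in> (pos - {p}) \<union> (neg - {n}) \<Longrightarrow> w q = w' q" for w w'
          unfolding partial_trace_def
          using that by (intro sum.cong refl r_loc) (auto simp: P_def)
      qed (use fin disj in auto)
      then obtain d where d: "\<And>w. partial_trace p n r w =
          (\<Sum>m\<in>matchings (pos - {p}) (neg - {n}). d m * block_const m w)"
        unfolding fam_span_def by blast
      have "(\<lambda>w. \<Sum>m\<in>matchings (pos - {p}) (neg - {n}). d m * block_const (insert {p, n} m) w)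
          \<in> fam_span M block_const"
      proof (rule fam_span_sum)
        fix m assume "m \<in> matchings (pos - {p}) (neg - {n})"
        then have "insert {p, n} m \<in> M"
          unfolding M_def by (rule insert_matching[OF _ p n disj])
        then show "(\<lambda>w. d m * block_const (insert {p, n} m) w) \<in> fam_span M block_const"
          by (rule fam_span_scaled_member[OF finM])
      qed
      moreover have "(\<lambda>w. if w p = w n then partial_trace p n r w else 0) =
          (\<lambda>w. \<Sum>m\<in>matchings (pos - {p}) (neg - {n}). d m * block_const (insert {p, n} m) w)"
        by (simp add: d block_const_insert_pair fun_eq_iff)
      ultimately show ?thesis by simp
    qed
    then have "(\<lambda>w. \<Sum>n\<in>neg. \<Sum>p\<in>pos. if w p = w n then partial_trace p n r w else 0)
        \<in> fam_span M block_const"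
      by (intro fam_span_sum)
    then show ?thesis unfolding Z_eq[abs_def] .
  qed
  then have "0 = (\<Sum>w\<in>\<Omega>. Z w * cnj (r w))" using r_orth by simp
  also have "\<dots> = (\<Sum>a\<in>UNIV. \<Sum>b\<in>UNIV. \<Sum>w\<in>\<Omega>. R b a (R a b r) w * cnj (r w))"
    by (simp add: Z_def sum_distrib_right sum.swap[of _ _ \<Omega>])
  also have "\<dots> = (\<Sum>a\<in>UNIV. \<Sum>b\<in>UNIV. \<Sum>w\<in>\<Omega>. R a b r w * cnj (R a b r w))"
    by (simp add: R_adj)
  also have "\<dots> = of_real (\<Sum>a\<in>UNIV. \<Sum>b\<in>UNIV. \<Sum>w\<in>\<Omega>. (cmod (R a b r w))\<^sup>2)"
    by (simp only: of_real_sum complex_norm_square)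
  finally have "complex_of_real (\<Sum>a\<in>UNIV. \<Sum>b\<in>UNIV. \<Sum>w\<in>\<Omega>. (cmod (R a b r w))\<^sup>2) = 0"
    by (rule sym)
  then have "(\<Sum>a\<in>UNIV. \<Sum>b\<in>UNIV. \<Sum>w\<in>\<Omega>. (cmod (R a b r w))\<^sup>2) = 0"
    by (rule of_real_eq_0_iff[THEN iffD1])
  then have R0: "R a b r w = 0" if "w \<in> \<Omega>" for a b w
    using that fin\<Omega> by (simp add: sum_nonneg_eq_0_iff sum_nonneg)
  \<comment> \<open>the operators \<open>R a a\<close> add up to multiplication by \<open>card neg\<close>\<close>
  have r0: "r w = 0" if w: "w \<in> \<Omega>" for w
  proof -
    have "of_nat (card neg) * r w = (\<Sum>n\<in>neg. \<Sum>a\<in>UNIV. if w n = a then r (w(n := a)) else 0)"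
      by simp
    also have "\<dots> = (\<Sum>a\<in>UNIV. R a a r w)"
      unfolding R_def by (rule sum.swap)
    also have "\<dots> = 0" using R0 w by simp
    finally show ?thesis using Suc.hyps(2) by auto
  qed
  have "t w = (\<Sum>i\<in>M. c i * block_const i w)" for w
  proof -
    have "r w = r (restrict w P)" by (rule r_loc) simp
    also have "\<dots> = 0" by (rule r0) (simp add: \<Omega>_def)
    finally show ?thesis by (simp add: r_def)
  qed
  then show ?case unfolding M_def by (rule fam_spanI)
qed

section \<open>The unitary group, its determinant subgroups and the permutation matrices\<close>

lemma det_adj_mat: "det (adj_mat g) = cnj (det g)"
proof -
  have "det (map_matrix cnj g) = cnj (det g)"
    by (simp add: det_def map_matrix_def)
  moreover have "adj_mat g = transpose (map_matrix cnj g)"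
    by (simp add: adj_mat_def transpose_def map_matrix_def)
  ultimately show ?thesis by simp
qed

lemma cmod_det_unitary:
  assumes "g \<in> unitary_group"
  shows "cmod (det g) = 1"
proof -
  have "det g * cnj (det g) = 1"
    using assms by (simp add: unitary_group_iff flip: det_adj_mat det_mul)
  then have "complex_of_real ((cmod (det g))\<^sup>2) = 1" by (simp only: complex_norm_square)
  then have "(cmod (det g))\<^sup>2 = 1" by (rule of_real_eq_1_iff[THEN iffD1])
  then have "cmod (det g) = 1 \<or> cmod (det g) = -1" by (simp only: power2_eq_1_iff)
  then show ?thesis using norm_ge_zero[of "det g"] by linarith
qed

lemma adj_mat_adj_mat [simp]: "adj_mat (adj_mat g) = g"
  by (simp add: vec_eq_iff)

lemma adj_mat_mult: "adj_mat (g ** h) = adj_mat h ** adj_mat g"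
  by (simp add: vec_eq_iff matrix_matrix_mult_def mult.commute)

lemma adj_mat_1 [simp]: "adj_mat (mat 1) = mat 1"
  by (simp add: vec_eq_iff mat_def)

lemma unitary_group_mult:
  assumes "g \<in> unitary_group" "h \<in> unitary_group"
  shows "g ** h \<in> unitary_group"
proof -
  have "g ** h ** (adj_mat h ** adj_mat g) = g ** (h ** adj_mat h) ** adj_mat g"
    "adj_mat h ** adj_mat g ** (g ** h) = adj_mat h ** (adj_mat g ** g) ** h"
    by (simp_all add: matrix_mul_assoc)
  then show ?thesis using assms by (simp add: unitary_group_iff adj_mat_mult)
qed

lemma unitary_subgroup_unitary_group: "unitary_subgroup unitary_group"
  unfolding unitary_subgroup_def
  by (auto simp: unitary_group_mult) (simp_all add: unitary_group_iff)

lemma unitary_group_det_infinity: "unitary_group_det \<infinity> = unitary_group"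
  by (auto simp: unitary_group_det_def root_group_def cmod_det_unitary)

lemma unitary_subgroup_unitary_group_det: "unitary_subgroup (unitary_group_det d)"
proof -
  have "1 \<in> root_group d" "z \<in> root_group d \<Longrightarrow> w \<in> root_group d \<Longrightarrow> z * w \<in> root_group d"
    "z \<in> root_group d \<Longrightarrow> cnj z \<in> root_group d" for z w
    by (auto simp: root_group_def norm_mult power_mult_distrib split: enat.splits)
      (metis complex_cnj_one complex_cnj_power)
  then show ?thesis
    using unitary_subgroup_unitary_group
    by (auto simp: unitary_subgroup_def unitary_group_det_def det_mul det_adj_mat)
qed

lemma unitary_groupI:
  assumes "\<And>i j. (\<Sum>m\<in>UNIV. g $ i $ m * cnj (g $ j $ m)) = (if i = j then 1 else 0)"
    and "\<And>i j. (\<Sum>m\<in>UNIV. cnj (g $ m $ i) * g $ m $ j) = (if i = j then 1 else 0)"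
  shows "g \<in> unitary_group"
  using assms by (simp add: unitary_group_iff vec_eq_iff matrix_matrix_mult_def mat_def)

lemma permutation_group_subset: "permutation_group \<subseteq> unitary_group"
proof
  fix g :: "complex^'n^'n"
  assume "g \<in> permutation_group"
  then obtain \<sigma> where \<sigma>: "bij \<sigma>" and g: "g = (\<chi> i j. if i = \<sigma> j then 1 else 0)"
    by (auto simp: permutation_group_def)
  have inv: "i = \<sigma> m \<longleftrightarrow> m = inv \<sigma> i" for i m
    using \<sigma> by (metis bij_inv_eq_iff)
  show "g \<in> unitary_group"
  proof (rule unitary_groupI)
    fix i j
    have "(\<Sum>m\<in>UNIV. g $ i $ m * cnj (g $ j $ m)) =
        (\<Sum>m\<in>UNIV. if m = inv \<sigma> i then (if m = inv \<sigma> j then 1 else 0) else 0)"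
      by (intro sum.cong) (auto simp: g inv)
    also have "\<dots> = (if inv \<sigma> i = inv \<sigma> j then 1 else 0)" by simp
    also have "inv \<sigma> i = inv \<sigma> j \<longleftrightarrow> i = j"
      using \<sigma> by (metis bij_inv_eq_iff)
    finally show "(\<Sum>m\<in>UNIV. g $ i $ m * cnj (g $ j $ m)) = (if i = j then 1 else 0)" .
    have "(\<Sum>m\<in>UNIV. cnj (g $ m $ i) * g $ m $ j) =
        (\<Sum>m\<in>UNIV. if m = \<sigma> i then (if m = \<sigma> j then 1 else 0) else 0)"
      by (intro sum.cong) (auto simp: g)
    also have "\<dots> = (if \<sigma> i = \<sigma> j then 1 else 0)" by simp
    also have "\<sigma> i = \<sigma> j \<longleftrightarrow> i = j" using \<sigma> by (simp add: bij_is_inj inj_eq)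
    finally show "(\<Sum>m\<in>UNIV. cnj (g $ m $ i) * g $ m $ j) = (if i = j then 1 else 0)" .
  qed
qed

lemma permutation_group_nonempty: "permutation_group \<noteq> {}"
  unfolding permutation_group_def using bij_id by blast

section \<open>Intertwiners as invariant tensors\<close>

text \<open>
  The entries of the tensor power \<open>g\<^sup>k\<close>, the values of \<open>u_pow\<close> at \<open>g\<close>.
\<close>

definition upow :: "complex^'n^'n \<Rightarrow> colored \<Rightarrow> 'n list \<Rightarrow> 'n list \<Rightarrow> complex" where
  "upow g k m i = (\<Prod>n<length k. entry g (k ! n) (m ! n) (i ! n))"

lemma upow_Nil [simp]: "upow g [] m i = 1"
  by (simp add: upow_def)

lemma upow_Cons [simp]: "upow g (c # k) (a # m) (b # i) = entry g c a b * upow g k m i"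
  by (simp add: upow_def prod.lessThan_Suc_shift del: prod.lessThan_Suc)

lemma ev_u_pow:
  assumes "length m = length k" "length i = length k"
  shows "ev g (u_pow k m i) = upow g k m i"
  using assms
proof (induction k arbitrary: m i)
  case (Cons c k)
  then show ?case by (cases m; cases i) (auto simp: ev_mult)
qed simp

definition intertwines ::
  "complex^'n^'n \<Rightarrow> colored \<Rightarrow> colored \<Rightarrow> ('n list \<Rightarrow> 'n list \<Rightarrow> complex) \<Rightarrow> bool" where
  "intertwines g k l T \<longleftrightarrow> (\<forall>j i. length j = length l \<longrightarrow> length i = length k \<longrightarrow>
     (\<Sum>m | length m = length k. T j m * upow g k m i) =
     (\<Sum>m | length m = length l. upow g l j m * T m i))"

definition supported :: "colored \<Rightarrow> colored \<Rightarrow> ('n list \<Rightarrow> 'n list \<Rightarrow> complex) \<Rightarrow> bool" where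
  "supported k l T \<longleftrightarrow> (\<forall>j i. T j i \<noteq> 0 \<longrightarrow> length j = length l \<and> length i = length k)"

lemma tannaka_hom_classical:
  assumes "G \<subseteq> unitary_group" "G \<noteq> {}"
  shows "T \<in> tannaka_hom (classical G) k l \<longleftrightarrow> supported k l T \<and> (\<forall>g\<in>G. intertwines g k l T)"
proof -
  have "ev g ((\<Sum>m | length m = length k. scal (T j m) (u_pow k m i))
         - (\<Sum>m | length m = length l. scal (T m i) (u_pow l j m))) =
      (\<Sum>m | length m = length k. T j m * upow g k m i) -
      (\<Sum>m | length m = length l. upow g l j m * T m i)"
    if "length j = length l" "length i = length k" for g j i
    using that by (simp add: ev_diff ev_sum ev_scal ev_u_pow mult.commute)
  then show ?thesis
    by (auto simp: tannaka_hom_def supported_def classical_eq_0_iff[OF assms] intertwines_def)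
qed

lemma finite_words: "finite {m :: 'n::finite list. length m = n}"
  using finite_lists_length_eq[of "UNIV :: 'n set" n] by simp

lemma sum_words_Suc:
  "(\<Sum>m | length (m :: 'n::finite list) = Suc n. f m) = (\<Sum>c\<in>UNIV. \<Sum>m | length m = n. f (c # m))"
proof -
  have "(\<Sum>m | length (m :: 'n list) = Suc n. f m) =
      (\<Sum>(c, m)\<in>UNIV \<times> {m. length m = n}. f (c # m))"
    by (rule sum.reindex_bij_witness[of _ "\<lambda>(c, m). c # m" "\<lambda>m. (hd m, tl m)"])
      (auto simp: length_Suc_conv)
  then show ?thesis by (simp add: sum.cartesian_product)
qed

lemma entry_unitary:
  assumes "g \<in> unitary_group"
  shows "(\<Sum>m\<in>UNIV. entry g c i m * cnj (entry g c j m)) = (if i = j then 1 else 0)"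
    and "(\<Sum>m\<in>UNIV. cnj (entry g c m i) * entry g c m j) = (if i = j then 1 else 0)"
  using unitary_rows[OF assms, of i j] unitary_rows[OF assms, of j i]
  by (cases c; auto simp: entry_def mult.commute)+

lemma upow_unitary:
  fixes g :: "complex^'n^'n"
  assumes g: "g \<in> unitary_group" and "length i = length k" "length j = length k"
  shows "(\<Sum>m | length m = length k. upow g k i m * cnj (upow g k j m)) = (if i = j then 1 else 0)"
    and "(\<Sum>m | length m = length k. cnj (upow g k m i) * upow g k m j) = (if i = j then 1 else 0)"
proof -
  show "(\<Sum>m | length m = length k. upow g k i m * cnj (upow g k j m)) = (if i = j then 1 else 0)"
    using assms(2,3)
  proof (induction k arbitrary: i j)
    case (Cons c k)
    obtain a i' b j' where ij: "i = a # i'" "j = b # j'" "length i' = length k" "length j' = length k"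
      using Cons.prems by (auto simp: length_Suc_conv)
    have "(\<Sum>m | length m = length (c # k). upow g (c # k) i m * cnj (upow g (c # k) j m)) =
        (\<Sum>d\<in>UNIV. entry g c a d * cnj (entry g c b d)) *
        (\<Sum>m | length m = length k. upow g k i' m * cnj (upow g k j' m))"
      by (simp add: sum_words_Suc ij sum_product mult_ac)
    then show ?case using Cons.IH[OF ij(3,4)] entry_unitary(1)[OF g] ij by simp
  qed simp
  show "(\<Sum>m | length m = length k. cnj (upow g k m i) * upow g k m j) = (if i = j then 1 else 0)"
    using assms(2,3)
  proof (induction k arbitrary: i j)
    case (Cons c k)
    obtain a i' b j' where ij: "i = a # i'" "j = b # j'" "length i' = length k" "length j' = length k"
      using Cons.prems by (auto simp: length_Suc_conv)
    have "(\<Sum>m | length m = length (c # k). cnj (upow g (c # k) m i) * upow g (c # k) m j) =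
        (\<Sum>d\<in>UNIV. cnj (entry g c d a) * entry g c d b) *
        (\<Sum>m | length m = length k. cnj (upow g k m i') * upow g k m j')"
      by (simp add: sum_words_Suc ij sum_product mult_ac)
    then show ?case using Cons.IH[OF ij(3,4)] entry_unitary(2)[OF g] ij by simp
  qed simp
qed

text \<open>
  The entries of \<open>g\<^sup>l T (g\<^sup>k)\<^sup>*\<close>. For unitary \<open>g\<close> it equals \<open>T\<close> iff \<open>T\<close> intertwines.
\<close>

definition conj_sum ::
  "complex^'n^'n \<Rightarrow> colored \<Rightarrow> colored \<Rightarrow> ('n list \<Rightarrow> 'n list \<Rightarrow> complex) \<Rightarrow> 'n list \<Rightarrow> 'n list \<Rightarrow> complex"
  where
  "conj_sum g k l T j i = (\<Sum>j' | length j' = length l. \<Sum>i' | length i' = length k.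
     upow g l j j' * T j' i' * cnj (upow g k i i'))"

lemma intertwines_iff_conj:
  fixes g :: "complex^'n^'n"
  assumes g: "g \<in> unitary_group"
  shows "intertwines g k l T \<longleftrightarrow> (\<forall>j i. length j = length l \<longrightarrow> length i = length k \<longrightarrow>
    conj_sum g k l T j i = T j i)"
proof -
  let ?K = "{m :: 'n list. length m = length k}" and ?L = "{m :: 'n list. length m = length l}"
  have fin: "finite ?K" "finite ?L" by (rule finite_words)+
  define L where "L j i = (\<Sum>m\<in>?L. upow g l j m * T m i)" for j i
  define R where "R j i = (\<Sum>m\<in>?K. T j m * upow g k m i)" for j i
  have conj: "conj_sum g k l T j i = (\<Sum>m\<in>?K. L j m * cnj (upow g k i m))" for j i
    unfolding conj_sum_def L_def sum_distrib_right by (rule sum.swap)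
  have to: "(\<Sum>m\<in>?K. R j m * cnj (upow g k i m)) = T j i" if "length i = length k" for j i
  proof -
    have "(\<Sum>m\<in>?K. R j m * cnj (upow g k i m)) =
        (\<Sum>m'\<in>?K. T j m' * (\<Sum>m\<in>?K. upow g k m' m * cnj (upow g k i m)))"
      unfolding R_def sum_distrib_right sum_distrib_left by (subst sum.swap) (simp add: mult.assoc)
    also have "\<dots> = (\<Sum>m'\<in>?K. if m' = i then T j m' else 0)"
      using that by (intro sum.cong) (auto simp: upow_unitary(1)[OF g])
    finally show ?thesis using that fin by simp
  qed
  have fro: "(\<Sum>m\<in>?K. conj_sum g k l T j m * upow g k m i) = L j i" if "length i = length k" for j i
  proof -
    have "(\<Sum>m\<in>?K. conj_sum g k l T j m * upow g k m i) =
        (\<Sum>m'\<in>?K. L j m' * (\<Sum>m\<in>?K. cnj (upow g k m m') * upow g k m i))"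
      unfolding conj sum_distrib_right sum_distrib_left by (subst sum.swap) (simp add: mult.assoc)
    also have "\<dots> = (\<Sum>m'\<in>?K. if m' = i then L j m' else 0)"
      using that by (intro sum.cong) (auto simp: upow_unitary(2)[OF g])
    finally show ?thesis using that fin by simp
  qed
  show ?thesis
  proof
    assume "intertwines g k l T"
    then have LR: "R j i = L j i" if "length j = length l" "length i = length k" for j i
      using that by (simp add: intertwines_def L_def R_def)
    show "\<forall>j i. length j = length l \<longrightarrow> length i = length k \<longrightarrow> conj_sum g k l T j i = T j i"
    proof (intro allI impI)
      fix j i :: "'n list" assume len: "length j = length l" "length i = length k"
      have "conj_sum g k l T j i = (\<Sum>m\<in>?K. R j m * cnj (upow g k i m))"
        unfolding conj using LR len by (intro sum.cong) auto
      then show "conj_sum g k l T j i = T j i" using to[OF len(2)] by simp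
    qed
  next
    assume *: "\<forall>j i. length j = length l \<longrightarrow> length i = length k \<longrightarrow> conj_sum g k l T j i = T j i"
    have "R j i = L j i" if len: "length j = length l" "length i = length k" for j i
    proof -
      have "R j i = (\<Sum>m\<in>?K. conj_sum g k l T j m * upow g k m i)"
        unfolding R_def using * len by (intro sum.cong) auto
      then show ?thesis using fro[OF len(2)] by simp
    qed
    then show "intertwines g k l T" by (simp add: intertwines_def L_def R_def)
  qed
qed

text \<open>
  The points of the partitions in \<open>P(k, l)\<close>. In the tensor associated with a linear map, \<open>g\<close> acts at a lower
  white point and its conjugate at a lower black point. At the upper points the colors are exchanged,
  as the source is dualized; \<open>pcolor\<close> is the resulting color.
\<close>

definition points :: "colored \<Rightarrow> colored \<Rightarrow> (nat + nat) set" where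
  "points k l = {..<length k} <+> {..<length l}"

definition pcolor :: "colored \<Rightarrow> colored \<Rightarrow> nat + nat \<Rightarrow> color" where
  "pcolor k l q = (case q of Inl n \<Rightarrow> flip (k ! n) | Inr n \<Rightarrow> l ! n)"

text \<open>
  The matrix \<open>T\<close> as a function of one word on all points.
\<close>

definition tens ::
  "colored \<Rightarrow> colored \<Rightarrow> ('n list \<Rightarrow> 'n list \<Rightarrow> complex) \<Rightarrow> (nat + nat \<Rightarrow> 'n) \<Rightarrow> complex" where
  "tens k l T w = T (map (\<lambda>n. w (Inr n)) [0..<length l]) (map (\<lambda>n. w (Inl n)) [0..<length k])"

text \<open>
  Invariance of a tensor under \<open>g\<close>, acting at the positions in \<open>P\<close> according to their colors.
\<close>

definition invariant ::
  "complex^'n^'n \<Rightarrow> 'p set \<Rightarrow> ('p \<Rightarrow> color) \<Rightarrow> (('p \<Rightarrow> 'n) \<Rightarrow> complex) \<Rightarrow> bool" where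
  "invariant g P col t \<longleftrightarrow> (\<forall>w.
     (\<Sum>w'\<in>P \<rightarrow>\<^sub>E UNIV. (\<Prod>q\<in>P. entry g (col q) (w q) (w' q)) * t w') = t w)"

lemma finite_points [simp]: "finite (points k l)"
  by (simp add: points_def)

lemma points_simps [simp]: "Inl n \<in> points k l \<longleftrightarrow> n < length k" "Inr n \<in> points k l \<longleftrightarrow> n < length l"
  by (auto simp: points_def)

lemma tens_cong: "(\<And>q. q \<in> points k l \<Longrightarrow> w q = w' q) \<Longrightarrow> tens k l T w = tens k l T w'"
  unfolding tens_def by (intro arg_cong2[where f = T] map_cong) auto

lemma tens_case_sum:
  assumes "length j = length l" "length i = length k"
  shows "tens k l T (case_sum ((!) i) ((!) j)) = T j i"
  using assms by (simp add: tens_def flip: assms) (simp add: map_nth)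

lemma conj_sum_eq_invariant_sum:
  fixes g :: "complex^'n^'n"
  shows "(\<Sum>w'\<in>points k l \<rightarrow>\<^sub>E UNIV. (\<Prod>q\<in>points k l. entry g (pcolor k l q) (w q) (w' q)) * tens k l T w') =
    tens k l (conj_sum g k l T) w"
proof -
  let ?j = "\<lambda>w. map (\<lambda>n. w (Inr n)) [0..<length l]" and ?i = "\<lambda>w. map (\<lambda>n. w (Inl n)) [0..<length k]"
  have prod: "(\<Prod>q\<in>points k l. entry g (pcolor k l q) (w q) (w' q)) =
      upow g l (?j w) (?j w') * cnj (upow g k (?i w) (?i w'))" for w' :: "nat + nat \<Rightarrow> 'n"
    by (simp add: points_def prod.Plus upow_def pcolor_def entry_flip mult.commute)
  have "(\<Sum>w'\<in>points k l \<rightarrow>\<^sub>E UNIV. (\<Prod>q\<in>points k l. entry g (pcolor k l q) (w q) (w' q)) * tens k l T w') =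
      (\<Sum>w'\<in>points k l \<rightarrow>\<^sub>E UNIV. upow g l (?j w) (?j w') * T (?j w') (?i w') * cnj (upow g k (?i w) (?i w')))"
    unfolding prod tens_def by (simp add: mult_ac)
  also have "\<dots> = (\<Sum>(j', i')\<in>{j'. length j' = length l} \<times> {i'. length i' = length k}.
      upow g l (?j w) j' * T j' i' * cnj (upow g k (?i w) i'))"
  proof (rule sum.reindex_bij_witness[of _
        "\<lambda>(j', i'). restrict (case_sum ((!) i') ((!) j')) (points k l)" "\<lambda>w'. (?j w', ?i w')"])
    fix w' :: "nat + nat \<Rightarrow> 'n" assume w': "w' \<in> points k l \<rightarrow>\<^sub>E UNIV"
    show "(case (?j w', ?i w') of (j', i') \<Rightarrow> restrict (case_sum ((!) i') ((!) j')) (points k l)) = w'"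
    proof
      fix q
      show "(case (?j w', ?i w') of (j', i') \<Rightarrow> restrict (case_sum ((!) i') ((!) j')) (points k l)) q = w' q"
        using w' by (cases q) (auto simp: PiE_iff extensional_def restrict_def)
    qed
  next
    fix x :: "'n list \<times> 'n list"
    assume "x \<in> {j'. length j' = length l} \<times> {i'. length i' = length k}"
    then obtain j' i' where x: "x = (j', i')" "length j' = length l" "length i' = length k" by auto
    have "map (\<lambda>n. restrict (case_sum ((!) i') ((!) j')) (points k l) (Inr n)) [0..<length l] = j'"
      "map (\<lambda>n. restrict (case_sum ((!) i') ((!) j')) (points k l) (Inl n)) [0..<length k] = i'"
      using x by (auto intro!: nth_equalityI)
    then show "(\<lambda>w'. (?j w', ?i w')) (case x of (j', i') \<Rightarrow> restrict (case_sum ((!) i') ((!) j')) (points k l)) = x"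
      by (simp add: x)
  qed auto
  finally show ?thesis
    by (simp add: tens_def conj_sum_def sum.cartesian_product)
qed

lemma intertwines_iff_invariant:
  fixes g :: "complex^'n^'n"
  assumes g: "g \<in> unitary_group"
  shows "intertwines g k l T \<longleftrightarrow> invariant g (points k l) (pcolor k l) (tens k l T)"
proof -
  have "invariant g (points k l) (pcolor k l) (tens k l T) \<longleftrightarrow>
      (\<forall>w. tens k l (conj_sum g k l T) w = tens k l T w)"
    by (simp add: invariant_def conj_sum_eq_invariant_sum)
  also have "\<dots> \<longleftrightarrow> (\<forall>j i. length j = length l \<longrightarrow> length i = length k \<longrightarrow> conj_sum g k l T j i = T j i)"
  proof
    assume *: "\<forall>w. tens k l (conj_sum g k l T) w = tens k l T w"
    show "\<forall>j i. length j = length l \<longrightarrow> length i = length k \<longrightarrow> conj_sum g k l T j i = T j i"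
      using * tens_case_sum by metis
  qed (simp add: tens_def)
  finally show ?thesis by (simp add: intertwines_iff_conj[OF g])
qed

text \<open>
  Words that are constant on the blocks of \<open>\<pi>\<close> correspond to functions on \<open>\<pi>\<close>, so the sum factors over the
  blocks.
\<close>

lemma sum_block_const:
  fixes E :: "'p \<Rightarrow> 'n::finite \<Rightarrow> complex"
  assumes "finite P" and part: "partition_on P \<pi>"
  shows "(\<Sum>w\<in>P \<rightarrow>\<^sub>E UNIV. (\<Prod>q\<in>P. E q (w q)) * block_const \<pi> w) =
    (\<Prod>B\<in>\<pi>. \<Sum>c\<in>UNIV. \<Prod>q\<in>B. E q c)"
proof -
  have UP: "\<Union>\<pi> = P" and ne: "\<And>B. B \<in> \<pi> \<Longrightarrow> B \<noteq> {}"
    using part by (auto simp: partition_on_def)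
  have disj: "B = B'" if "B \<in> \<pi>" "B' \<in> \<pi>" "x \<in> B" "x \<in> B'" for B B' x
    using part that unfolding partition_on_def disjoint_def by blast
  have fin\<pi>: "finite \<pi>" using finite_elements[OF assms(1) part] .
  have finB: "finite B" if "B \<in> \<pi>" for B
    using that UP assms(1) by (meson Union_upper finite_subset UP)
  have prodP: "prod f P = (\<Prod>B\<in>\<pi>. prod f B)" for f :: "'p \<Rightarrow> complex"
    unfolding UP[symmetric] using prod.Union_disjoint[of \<pi> f] finB disj by (auto simp: comp_def)
  define blk where "blk q = (THE B. B \<in> \<pi> \<and> q \<in> B)" for q
  have blk: "blk q = B" if "B \<in> \<pi>" "q \<in> B" for q B
    unfolding blk_def
  proof (rule the_equality)
    show "B \<in> \<pi> \<and> q \<in> B" using that by simp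
    show "B' = B" if "B' \<in> \<pi> \<and> q \<in> B'" for B'
      using disj[of B' B q] that \<open>B \<in> \<pi>\<close> \<open>q \<in> B\<close> by simp
  qed
  define pt where "pt B = (SOME q. q \<in> B)" for B :: "'p set"
  have pt: "pt B \<in> B" if "B \<in> \<pi>" for B
    unfolding pt_def using ne[OF that] by (simp add: some_in_eq)
  define K where "K w \<longleftrightarrow> (\<forall>B\<in>\<pi>. \<forall>x\<in>B. \<forall>y\<in>B. w x = w y)" for w :: "'p \<Rightarrow> 'n"
  have bc: "block_const \<pi> w = (if K w then 1 else 0)" for w :: "'p \<Rightarrow> 'n"
    by (simp only: block_const_def K_def)
  let ?C = "{w \<in> P \<rightarrow>\<^sub>E (UNIV :: 'n set). K w}"
  have "(\<Sum>w\<in>P \<rightarrow>\<^sub>E UNIV. (\<Prod>q\<in>P. E q (w q)) * block_const \<pi> w) =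
      (\<Sum>w\<in>P \<rightarrow>\<^sub>E UNIV. if K w then \<Prod>q\<in>P. E q (w q) else 0)"
    by (intro sum.cong) (simp_all add: bc)
  also have "\<dots> = (\<Sum>w\<in>?C. \<Prod>q\<in>P. E q (w q))"
    using assms(1) by (intro sum.inter_filter[symmetric]) (simp add: finite_PiE)
  also have "\<dots> = (\<Sum>v\<in>\<pi> \<rightarrow>\<^sub>E UNIV. \<Prod>B\<in>\<pi>. \<Prod>q\<in>B. E q (v B))"
  proof (rule sum.reindex_bij_witness[of _ "\<lambda>v. \<lambda>q\<in>P. v (blk q)" "\<lambda>w. \<lambda>B\<in>\<pi>. w (pt B)"])
    fix w assume w: "w \<in> ?C"
    have const: "w x = w y" if "B \<in> \<pi>" "x \<in> B" "y \<in> B" for B x y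
      using w that unfolding K_def by blast
    show "(\<lambda>q\<in>P. (\<lambda>B\<in>\<pi>. w (pt B)) (blk q)) = w"
    proof
      fix q
      show "(\<lambda>q\<in>P. (\<lambda>B\<in>\<pi>. w (pt B)) (blk q)) q = w q"
      proof (cases "q \<in> P")
        case True
        then obtain B where B: "B \<in> \<pi>" "q \<in> B" using UP by blast
        then show ?thesis using True blk[OF B] const[OF B(1) pt[OF B(1)] B(2)] by simp
      next
        case False
        then show ?thesis using w by (auto simp: PiE_iff extensional_def)
      qed
    qed
    show "(\<lambda>B\<in>\<pi>. w (pt B)) \<in> \<pi> \<rightarrow>\<^sub>E UNIV" by simp
    show "(\<Prod>B\<in>\<pi>. \<Prod>q\<in>B. E q ((\<lambda>B\<in>\<pi>. w (pt B)) B)) = (\<Prod>q\<in>P. E q (w q))"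
      unfolding prodP
    proof (intro prod.cong refl)
      fix B q assume "B \<in> \<pi>" "q \<in> B"
      then show "E q ((\<lambda>B\<in>\<pi>. w (pt B)) B) = E q (w q)" using const[of B "pt B" q] pt by simp
    qed
  next
    fix v :: "'p set \<Rightarrow> 'n" assume v: "v \<in> \<pi> \<rightarrow>\<^sub>E UNIV"
    have eq: "(\<lambda>q\<in>P. v (blk q)) q = v B" if "B \<in> \<pi>" "q \<in> B" for B q
      using that UP blk by auto
    show "(\<lambda>B\<in>\<pi>. (\<lambda>q\<in>P. v (blk q)) (pt B)) = v"
    proof
      fix B show "(\<lambda>B\<in>\<pi>. (\<lambda>q\<in>P. v (blk q)) (pt B)) B = v B"
        using v eq[OF _ pt] by (cases "B \<in> \<pi>") (auto simp: PiE_iff extensional_def)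
    qed
    show "(\<lambda>q\<in>P. v (blk q)) \<in> ?C"
    proof -
      have "K (\<lambda>q\<in>P. v (blk q))" unfolding K_def
      proof (intro ballI)
        fix B x y assume "B \<in> \<pi>" "x \<in> B" "y \<in> B"
        then show "(\<lambda>q\<in>P. v (blk q)) x = (\<lambda>q\<in>P. v (blk q)) y"
          using eq[of B x] eq[of B y] by simp
      qed
      then show ?thesis by simp
    qed
  qed
  also have "\<dots> = (\<Prod>B\<in>\<pi>. \<Sum>c\<in>UNIV. \<Prod>q\<in>B. E q c)"
    using prod_sum_PiE[OF fin\<pi>, of "\<lambda>_. UNIV" "\<lambda>B c. \<Prod>q\<in>B. E q c"] by simp
  finally show ?thesis .
qed

lemma prod_indicator:
  "finite F \<Longrightarrow> (\<Prod>B\<in>F. if Q B then 1 else (0 :: complex)) = (if \<forall>B\<in>F. Q B then 1 else 0)"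
  by (induction F rule: finite_induct) auto

lemma invariant_block_const_matching:
  fixes g :: "complex^'n^'n" and P :: "'p set"
  assumes g: "g \<in> unitary_group" and fin: "finite P"
    and m: "\<pi> \<in> matchings {q \<in> P. col q = White} {q \<in> P. col q = Black}"
  shows "invariant g P col (block_const \<pi>)"
  unfolding invariant_def
proof
  fix w :: "'p \<Rightarrow> 'n"
  have P: "{q \<in> P. col q = White} \<union> {q \<in> P. col q = Black} = P"
    using color.exhaust by blast
  have part: "partition_on P \<pi>" using m by (simp add: matchings_def P)
  have bl: "\<exists>p n. col p = White \<and> col n = Black \<and> B = {p, n}" if "B \<in> \<pi>" for B
    using m that unfolding matchings_def by (simp, blast)
  have "(\<Sum>c\<in>UNIV. \<Prod>q\<in>B. entry g (col q) (w q) c) = (if \<forall>x\<in>B. \<forall>y\<in>B. w x = w y then 1 else 0)"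
    if B: "B \<in> \<pi>" for B
  proof -
    obtain p n where pn: "col p = White" "col n = Black" "B = {p, n}" using bl[OF B] by blast
    then have "p \<noteq> n" by auto
    then have "(\<Sum>c\<in>UNIV. \<Prod>q\<in>B. entry g (col q) (w q) c) = (if w p = w n then 1 else 0)"
      using unitary_rows(1)[OF g, of "w p" "w n"] by (simp add: pn entry_def)
    moreover have "(\<forall>x\<in>B. \<forall>y\<in>B. w x = w y) \<longleftrightarrow> w p = w n" by (auto simp: pn)
    ultimately show ?thesis by (simp only:)
  qed
  then have "(\<Prod>B\<in>\<pi>. \<Sum>c\<in>UNIV. \<Prod>q\<in>B. entry g (col q) (w q) c) =
      (\<Prod>B\<in>\<pi>. if \<forall>x\<in>B. \<forall>y\<in>B. w x = w y then 1 else 0)"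
    by (rule prod.cong[OF refl])
  also have "\<dots> = block_const \<pi> w"
    unfolding block_const_def by (rule prod_indicator[OF finite_elements[OF fin part]])
  finally show "(\<Sum>w'\<in>P \<rightarrow>\<^sub>E UNIV. (\<Prod>q\<in>P. entry g (col q) (w q) (w' q)) * block_const \<pi> w') =
      block_const \<pi> w"
    using sum_block_const[OF fin part, of "\<lambda>q. entry g (col q) (w q)"] by simp
qed

section \<open>From group invariance to Lie algebra invariance\<close>

text \<open>
  The matrix \<open>1 + (e\<^sup>i\<^sup>\<theta> - 1) v v\<^sup>*\<close>, which is unitary for unit vectors \<open>v\<close>. Every Hermitian matrix is a
  combination of the \<open>v v\<^sup>*\<close>.
\<close>

definition rank_one_rot :: "('n \<Rightarrow> complex) \<Rightarrow> real \<Rightarrow> complex^'n^'n" where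
  "rank_one_rot v \<theta> = (\<chi> i j. (if i = j then 1 else 0) + (cis \<theta> - 1) * (v i * cnj (v j)))"

lemma sum_delta_plus_rank_one:
  fixes x y :: "'n::finite \<Rightarrow> complex"
  shows "(\<Sum>m\<in>UNIV. ((if i = m then 1 else 0) + p * x m) * ((if j = m then 1 else 0) + q * y m)) =
    (if i = j then 1 else 0) + q * y i + p * x j + p * q * (\<Sum>m\<in>UNIV. x m * y m)"
proof -
  have "((if i = m then 1 else 0) + p * x m) * ((if j = m then 1 else 0) + q * y m) =
      (if i = m then if j = m then 1 else 0 else 0) + (if i = m then q * y m else 0) +
      (if j = m then p * x m else 0) + p * q * (x m * y m)" for m
    by (simp add: algebra_simps)
  then show ?thesis by (simp add: sum.distrib sum_distrib_left)
qed

lemma rank_one_rot_unitary: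
  fixes v :: "'n::finite \<Rightarrow> complex"
  assumes v: "(\<Sum>c\<in>UNIV. cnj (v c) * v c) = 1"
  shows "rank_one_rot v \<theta> \<in> unitary_group"
proof (rule unitary_groupI)
  fix i j
  define z where "z = cis \<theta>"
  have zz: "z * cnj z = 1" by (simp add: z_def cis_cnj cis_mult)
  let ?p = "(z - 1) * v i" and ?q = "(cnj z - 1) * cnj (v j)"
  have "?q * v i + ?p * cnj (v j) + ?p * ?q = v i * cnj (v j) * (z * cnj z - 1)"
    by (simp add: algebra_simps)
  then have 1: "?q * v i + ?p * cnj (v j) + ?p * ?q = 0" by (simp add: zz)
  have "(\<Sum>m\<in>UNIV. rank_one_rot v \<theta> $ i $ m * cnj (rank_one_rot v \<theta> $ j $ m)) =
      (\<Sum>m\<in>UNIV. ((if i = m then 1 else 0) + ?p * cnj (v m)) * ((if j = m then 1 else 0) + ?q * v m))"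
    by (intro sum.cong) (simp_all add: rank_one_rot_def z_def mult_ac)
  also have "\<dots> = (if i = j then 1 else 0) + (?q * v i + ?p * cnj (v j) + ?p * ?q)"
    unfolding sum_delta_plus_rank_one v by (simp add: add.assoc)
  finally show "(\<Sum>m\<in>UNIV. rank_one_rot v \<theta> $ i $ m * cnj (rank_one_rot v \<theta> $ j $ m)) =
      (if i = j then 1 else 0)" by (simp add: 1)
  let ?p = "(cnj z - 1) * v i" and ?q = "(z - 1) * cnj (v j)"
  have "?q * v i + ?p * cnj (v j) + ?p * ?q = v i * cnj (v j) * (z * cnj z - 1)"
    by (simp add: algebra_simps)
  then have 2: "?q * v i + ?p * cnj (v j) + ?p * ?q = 0" by (simp add: zz)
  have "(\<Sum>m\<in>UNIV. cnj (rank_one_rot v \<theta> $ m $ i) * rank_one_rot v \<theta> $ m $ j) =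
      (\<Sum>m\<in>UNIV. ((if i = m then 1 else 0) + ?p * cnj (v m)) * ((if j = m then 1 else 0) + ?q * v m))"
    by (intro sum.cong) (auto simp: rank_one_rot_def z_def mult_ac)
  also have "\<dots> = (if i = j then 1 else 0) + (?q * v i + ?p * cnj (v j) + ?p * ?q)"
    unfolding sum_delta_plus_rank_one v by (simp add: add.assoc)
  finally show "(\<Sum>m\<in>UNIV. cnj (rank_one_rot v \<theta> $ m $ i) * rank_one_rot v \<theta> $ m $ j) =
      (if i = j then 1 else 0)" by (simp add: 2)
qed

text \<open>
  For \<open>u = v\<close> this is, up to the factor \<open>\<i>\<close>, the derivative of \<open>rank_one_rot v\<close> (for \<open>White\<close>) or of its
  conjugate (for \<open>Black\<close>) at \<open>\<theta> = 0\<close>. It is kept sesquilinear in \<open>u\<close> and \<open>v\<close> in order to polarize.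
\<close>

definition rot_form :: "color \<Rightarrow> ('n \<Rightarrow> complex) \<Rightarrow> ('n \<Rightarrow> complex) \<Rightarrow> 'n \<Rightarrow> 'n \<Rightarrow> complex" where
  "rot_form c u v a b = (case c of White \<Rightarrow> u a * cnj (v b) | Black \<Rightarrow> - (cnj (v a) * u b))"

lemma entry_rank_one_rot_0: "entry (rank_one_rot v 0) c a b = (if a = b then 1 else 0)"
  by (cases c) (simp_all add: entry_def rank_one_rot_def)

lemma has_derivative_entry_rank_one_rot:
  "((\<lambda>\<theta>. entry (rank_one_rot v \<theta>) c a b) has_derivative
    (\<lambda>h. of_real h * (\<i> * rot_form c v v a b))) (at 0)"
proof (cases c)
    case White
    show ?thesis unfolding White
      by (auto simp: entry_def rank_one_rot_def rot_form_def scaleR_conv_of_real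
        intro!: derivative_eq_intros)
  next
    case Black
    show ?thesis unfolding Black
      by (auto simp: entry_def rank_one_rot_def rot_form_def scaleR_conv_of_real cis_cnj
        intro!: derivative_eq_intros)
qed

lemma sum_words_agreeing_off:
  fixes t :: "('p \<Rightarrow> 'n::finite) \<Rightarrow> complex"
  assumes "finite P" "q \<in> P"
    and loc: "\<And>w w'. (\<And>q. q \<in> P \<Longrightarrow> w q = w' q) \<Longrightarrow> t w = t w'"
  shows "(\<Sum>w'\<in>P \<rightarrow>\<^sub>E UNIV. f (w' q) * (\<Prod>r\<in>P - {q}. if w r = w' r then 1 else 0) * t w') =
    (\<Sum>c\<in>UNIV. f c * t (w(q := c)))"
proof -
  define K where "K w' \<longleftrightarrow> (\<forall>r\<in>P - {q}. w r = w' r)" for w'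
  have fin: "finite (P \<rightarrow>\<^sub>E (UNIV :: 'n set))" using assms(1) by (simp add: finite_PiE)
  have "(\<Sum>w'\<in>P \<rightarrow>\<^sub>E UNIV. f (w' q) * (\<Prod>r\<in>P - {q}. if w r = w' r then 1 else 0) * t w') =
      (\<Sum>w'\<in>P \<rightarrow>\<^sub>E UNIV. if K w' then f (w' q) * t w' else 0)"
    using assms(1) by (intro sum.cong refl) (simp add: prod_indicator flip: K_def)
  also have "\<dots> = (\<Sum>w'\<in>{w' \<in> P \<rightarrow>\<^sub>E UNIV. K w'}. f (w' q) * t w')"
    using fin by (rule sum.inter_filter[symmetric])
  also have "\<dots> = (\<Sum>c\<in>UNIV. f c * t (w(q := c)))"
  proof (rule sum.reindex_bij_witness[of _ "\<lambda>c. restrict (w(q := c)) P" "\<lambda>w'. w' q"])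
    fix w' assume w': "w' \<in> {w' \<in> P \<rightarrow>\<^sub>E UNIV. K w'}"
    show eq: "restrict (w(q := w' q)) P = w'"
    proof
      fix r show "restrict (w(q := w' q)) P r = w' r"
        using w' by (auto simp: K_def PiE_iff extensional_def)
    qed
    have "t (w(q := w' q)) = t (restrict (w(q := w' q)) P)"
      by (rule loc) simp
    then show "f (w' q) * t (w(q := w' q)) = f (w' q) * t w'" unfolding eq by simp
  qed (use assms(2) in \<open>auto simp: K_def\<close>)
  finally show ?thesis .
qed

text \<open>
  The infinitesimal action of \<open>u v\<^sup>*\<close> on the tensor \<open>t\<close>, evaluated at \<open>w\<close>.
\<close>

definition tangent_sum :: "'p set \<Rightarrow> ('p \<Rightarrow> color) \<Rightarrow> (('p \<Rightarrow> 'n::finite) \<Rightarrow> complex) \<Rightarrow> ('p \<Rightarrow> 'n) \<Rightarrow>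
    ('n \<Rightarrow> complex) \<Rightarrow> ('n \<Rightarrow> complex) \<Rightarrow> complex" where
  "tangent_sum P col t w u v =
     (\<Sum>q\<in>P. \<Sum>c\<in>UNIV. rot_form (col q) u v (w q) c * t (w(q := c)))"

text \<open>
  The expression is the derivative at \<open>\<theta> = 0\<close>, up to a factor \<open>\<i>\<close>, of the constant function that sends \<open>\<theta>\<close>
  to the value at \<open>w\<close> of \<open>t\<close> transformed by \<open>rank_one_rot v \<theta>\<close>.
\<close>

lemma tangent_sum_unit:
  fixes t :: "('p \<Rightarrow> 'n::finite) \<Rightarrow> complex"
  assumes fin: "finite P"
    and loc: "\<And>w w'. (\<And>q. q \<in> P \<Longrightarrow> w q = w' q) \<Longrightarrow> t w = t w'"
    and inv: "\<And>g. g \<in> unitary_group \<Longrightarrow> invariant g P col t"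
    and v: "(\<Sum>c\<in>UNIV. cnj (v c) * v c) = 1"
  shows "tangent_sum P col t w v v = 0"
proof -
  let ?\<Omega> = "P \<rightarrow>\<^sub>E (UNIV :: 'n set)"
  let ?\<delta> = "\<lambda>q w'. \<Prod>r\<in>P - {q}. if w r = w' r then 1 else (0 :: complex)"
  define F where "F \<theta> = (\<Sum>w'\<in>?\<Omega>. (\<Prod>q\<in>P. entry (rank_one_rot v \<theta>) (col q) (w q) (w' q)) * t w')" for \<theta>
  define F' where "F' h = (\<Sum>w'\<in>?\<Omega>. (\<Sum>q\<in>P. of_real h * (\<i> * rot_form (col q) v v (w q) (w' q)) *
      (\<Prod>r\<in>P - {q}. entry (rank_one_rot v 0) (col r) (w r) (w' r))) * t w')" for h
  have "(F has_derivative F') (at 0)"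
    unfolding F_def F'_def
    by (intro has_derivative_sum has_derivative_mult_left has_derivative_prod
        has_derivative_entry_rank_one_rot)
  moreover have "F = (\<lambda>\<theta>. t w)"
    using inv[OF rank_one_rot_unitary[OF v]] by (simp add: F_def invariant_def fun_eq_iff)
  moreover have "((\<lambda>\<theta>. t w) has_derivative (\<lambda>h. 0)) (at (0 :: real))"
    by (rule has_derivative_const)
  ultimately have "F' = (\<lambda>h. 0)"
    using has_derivative_unique by blast
  then have "0 = F' 1" by simp
  also have "F' 1 = \<i> * (\<Sum>w'\<in>?\<Omega>. \<Sum>q\<in>P. rot_form (col q) v v (w q) (w' q) * ?\<delta> q w' * t w')"
    by (simp add: F'_def entry_rank_one_rot_0 sum_distrib_left sum_distrib_right mult_ac)
  also have "(\<Sum>w'\<in>?\<Omega>. \<Sum>q\<in>P. rot_form (col q) v v (w q) (w' q) * ?\<delta> q w' * t w') =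
      (\<Sum>q\<in>P. \<Sum>w'\<in>?\<Omega>. rot_form (col q) v v (w q) (w' q) * ?\<delta> q w' * t w')"
    by (rule sum.swap)
  also have "\<dots> = tangent_sum P col t w v v"
    unfolding tangent_sum_def
  proof (rule sum.cong[OF refl])
    fix q assume q: "q \<in> P"
    show "(\<Sum>w'\<in>?\<Omega>. rot_form (col q) v v (w q) (w' q) * ?\<delta> q w' * t w') =
        (\<Sum>c\<in>UNIV. rot_form (col q) v v (w q) c * t (w(q := c)))"
      by (rule sum_words_agreeing_off[OF fin q]) (rule loc)
  qed
  finally show ?thesis by simp
qed

lemma tangent_sum_add_left:
  "tangent_sum P col t w (\<lambda>c. u c + u' c) v = tangent_sum P col t w u v + tangent_sum P col t w u' v"
proof -
  have "rot_form c (\<lambda>c. u c + u' c) v a b = rot_form c u v a b + rot_form c u' v a b" for c a b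
    by (cases c) (simp_all add: rot_form_def algebra_simps)
  then show ?thesis by (simp add: tangent_sum_def ring_distribs sum.distrib)
qed

lemma tangent_sum_add_right:
  "tangent_sum P col t w u (\<lambda>c. v c + v' c) = tangent_sum P col t w u v + tangent_sum P col t w u v'"
proof -
  have "rot_form c u (\<lambda>c. v c + v' c) a b = rot_form c u v a b + rot_form c u v' a b" for c a b
    by (cases c) (simp_all add: rot_form_def algebra_simps)
  then show ?thesis by (simp add: tangent_sum_def ring_distribs sum.distrib)
qed

lemma tangent_sum_scale:
  "tangent_sum P col t w (\<lambda>c. k * u c) (\<lambda>c. k' * v c) = k * cnj k' * tangent_sum P col t w u v"
proof -
  have "rot_form c (\<lambda>c. k * u c) (\<lambda>c. k' * v c) a b = k * cnj k' * rot_form c u v a b" for c a b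
    by (cases c) (simp_all add: rot_form_def algebra_simps)
  then show ?thesis by (simp add: tangent_sum_def sum_distrib_left mult.assoc)
qed

lemma gl_invariant_of_invariant:
  fixes t :: "('p \<Rightarrow> 'n::finite) \<Rightarrow> complex"
  assumes fin: "finite P"
    and loc: "\<And>w w'. (\<And>q. q \<in> P \<Longrightarrow> w q = w' q) \<Longrightarrow> t w = t w'"
    and inv: "\<And>g. g \<in> unitary_group \<Longrightarrow> invariant g P col t"
  shows "gl_invariant {q \<in> P. col q = White} {q \<in> P. col q = Black} t"
  unfolding gl_invariant_def
proof (intro allI)
  fix a b :: 'n and w :: "'p \<Rightarrow> 'n"
  define S where "S = tangent_sum P col t w"
  have S_add: "S (\<lambda>c. u c + u' c) (\<lambda>c. v c + v' c) = S u v + S u v' + S u' v + S u' v'" for u u' v v'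
    by (simp add: S_def tangent_sum_add_left tangent_sum_add_right)
  have S_scale: "S (\<lambda>c. k * u c) (\<lambda>c. k' * v c) = k * cnj k' * S u v" for k k' u v
    by (simp add: S_def tangent_sum_scale)
  have S_diag: "S v v = 0" for v
  proof -
    define N where "N = (\<Sum>c\<in>UNIV. (cmod (v c))\<^sup>2)"
    have N: "complex_of_real N = (\<Sum>c\<in>UNIV. cnj (v c) * v c)"
      unfolding N_def of_real_sum complex_norm_square by (simp add: mult.commute)
    have N0: "0 \<le> N" by (simp add: N_def sum_nonneg)
    show ?thesis
    proof (cases "N = 0")
      case True
      then have "v = (\<lambda>c. 0 * v c)" by (simp add: N_def sum_nonneg_eq_0_iff fun_eq_iff)
      then show ?thesis using S_scale[of 0 v 0 v] by simp
    next
      case False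
      define k where "k = complex_of_real (1 / sqrt N)"
      have kk: "k * cnj k = 1 / complex_of_real N"
        using N0 by (simp add: k_def flip: of_real_mult)
      have "(\<Sum>c\<in>UNIV. cnj (k * v c) * (k * v c)) = (k * cnj k) * (\<Sum>c\<in>UNIV. cnj (v c) * v c)"
        by (simp add: sum_distrib_left mult_ac)
      also have "\<dots> = 1" using False by (simp add: kk flip: N)
      finally have "S (\<lambda>c. k * v c) (\<lambda>c. k * v c) = 0"
        unfolding S_def by (intro tangent_sum_unit fin inv loc)
      then show ?thesis using S_scale[of k v k v] kk False by simp
    qed
  qed
  \<comment> \<open>polarization with the vectors \<open>u + v\<close> and \<open>u + \<i> v\<close>\<close>
  have S_zero: "S u v = 0" for u v
  proof -
    have "S u v + S v u = 0"
      using S_add[of u v u v] S_diag[of "\<lambda>c. u c + v c"] S_diag by simp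
    moreover have "- (\<i> * S u v) + \<i> * S v u = 0"
      using S_add[of u "\<lambda>c. \<i> * v c" u "\<lambda>c. \<i> * v c"] S_diag[of "\<lambda>c. u c + \<i> * v c"]
        S_diag[of u] S_diag[of "\<lambda>c. \<i> * v c"] S_scale[of 1 u \<i> v] S_scale[of \<i> v 1 u] by simp
    then have "\<i> * (S v u - S u v) = 0" by (simp add: algebra_simps)
    then have "S v u = S u v" by simp
    ultimately show ?thesis by simp
  qed
  \<comment> \<open>\<open>u = e_a\<close> and \<open>v = e_b\<close> give the elementary matrix \<open>E_ab\<close>\<close>
  let ?e = "\<lambda>a c :: 'n. if c = a then 1 else (0 :: complex)"
  have "(\<Sum>c\<in>UNIV. rot_form (col q) (?e a) (?e b) (w q) c * t (w(q := c))) =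
      (if col q = White then (if w q = a then t (w(q := b)) else 0)
       else - (if w q = b then t (w(q := a)) else 0))" for q
  proof (cases "col q")
    case White
    have "(\<Sum>c\<in>UNIV. rot_form (col q) (?e a) (?e b) (w q) c * t (w(q := c))) =
        (\<Sum>c\<in>UNIV. if c = b then (if w q = a then t (w(q := c)) else 0) else 0)"
      by (intro sum.cong) (auto simp: White rot_form_def)
    then show ?thesis by (simp add: White)
  next
    case Black
    have "(\<Sum>c\<in>UNIV. rot_form (col q) (?e a) (?e b) (w q) c * t (w(q := c))) =
        (\<Sum>c\<in>UNIV. if c = a then - (if w q = b then t (w(q := c)) else 0) else 0)"
      by (intro sum.cong) (auto simp: Black rot_form_def)
    then show ?thesis by (simp add: Black)
  qed
  then have "(\<Sum>q\<in>P. if col q = White then (if w q = a then t (w(q := b)) else 0)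
       else - (if w q = b then t (w(q := a)) else 0)) = 0"
    using S_zero[of "?e a" "?e b"] by (simp add: S_def tangent_sum_def)
  moreover have "{q \<in> P. col q \<noteq> White} = {q \<in> P. col q = Black}"
    by (metis color.distinct(1) color.exhaust)
  ultimately show "(\<Sum>p\<in>{q \<in> P. col q = White}. if w p = a then t (w(p := b)) else 0) =
      (\<Sum>n\<in>{q \<in> P. col q = Black}. if w n = b then t (w(n := a)) else 0)"
    using fin by (simp add: sum.If_cases Int_def sum_negf Collect_neg_eq[symmetric])
qed

section \<open>Intertwiners of the unitary group\<close>

lemma partitions_eq: "partitions k l = {\<pi>. partition_on (points k l) \<pi>}"
  by (simp add: partitions_def points_def)

lemma finite_partitions: "finite (partitions k l)"
proof (rule finite_subset)
  show "partitions k l \<subseteq> Pow (Pow (points k l))"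
    by (auto simp: partitions_eq partition_on_def)
qed simp

text \<open>
  The white points are those at which the group acts by \<open>g\<close>, the black points those at which it acts
  by the complex conjugate of \<open>g\<close>.
\<close>

abbreviation white_points :: "colored \<Rightarrow> colored \<Rightarrow> (nat + nat) set" where
  "white_points k l \<equiv> {q \<in> points k l. pcolor k l q = White}"

abbreviation black_points :: "colored \<Rightarrow> colored \<Rightarrow> (nat + nat) set" where
  "black_points k l \<equiv> {q \<in> points k l. pcolor k l q = Black}"

lemma white_black_points: "white_points k l \<union> black_points k l = points k l"
  "white_points k l \<inter> black_points k l = {}"
proof -
  have "c = White \<or> c = Black" for c by (cases c) auto
  then show "white_points k l \<union> black_points k l = points k l" by auto
  show "white_points k l \<inter> black_points k l = {}" by auto
qed

lemma T_part_eq: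
  assumes "length j = length l" "length i = length k"
  shows "T_part k l \<pi> j i = block_const \<pi> (case_sum ((!) i) ((!) j))"
  using assms by (simp add: T_part_def block_const_def)

lemma supported_T_part: "supported k l (T_part k l \<pi>)"
  by (simp add: supported_def T_part_def)

lemma tens_T_part:
  assumes "\<pi> \<in> partitions k l"
  shows "tens k l (T_part k l \<pi>) = block_const \<pi>"
proof
  fix w :: "nat + nat \<Rightarrow> 'n"
  have "tens k l (T_part k l \<pi>) w = block_const \<pi> (case_sum
      ((!) (map (\<lambda>n. w (Inl n)) [0..<length k])) ((!) (map (\<lambda>n. w (Inr n)) [0..<length l])))"
    unfolding tens_def by (rule T_part_eq) simp_all
  also have "\<dots> = block_const \<pi> w"
  proof (rule block_const_cong)
    show "partition_on (points k l) \<pi>" using assms by (simp add: partitions_eq)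
    show "case_sum ((!) (map (\<lambda>n. w (Inl n)) [0..<length k]))
        ((!) (map (\<lambda>n. w (Inr n)) [0..<length l])) q = w q" if "q \<in> points k l" for q
      using that by (cases q) auto
  qed
  finally show "tens k l (T_part k l \<pi>) w = block_const \<pi> w" .
qed

lemma unitary_group_nonempty: "unitary_group \<noteq> {}"
  using unitary_subgroup_unitary_group by (auto simp: unitary_subgroup_def)

lemma matching_T_part_in_tannaka_hom:
  assumes "\<pi> \<in> matchings (white_points k l) (black_points k l)"
  shows "\<pi> \<in> partitions k l"
    and "T_part k l \<pi> \<in> tannaka_hom (classical (unitary_group :: (complex^'n^'n) set)) k l"
proof -
  show \<pi>: "\<pi> \<in> partitions k l"
    using assms white_black_points(1) by (simp add: partitions_eq matchings_def)
  have "intertwines g k l (T_part k l \<pi>)" if g: "g \<in> unitary_group" for g :: "complex^'n^'n"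
    unfolding intertwines_iff_invariant[OF g] tens_T_part[OF \<pi>]
    by (rule invariant_block_const_matching[OF g finite_points assms])
  then show "T_part k l \<pi> \<in> tannaka_hom (classical (unitary_group :: (complex^'n^'n) set)) k l"
    by (simp add: tannaka_hom_classical unitary_group_nonempty supported_T_part)
qed

lemma tannaka_hom_unitary_group_span:
  assumes T: "T \<in> tannaka_hom (classical (unitary_group :: (complex^'n^'n) set)) k l"
  shows "\<exists>a. T = (\<lambda>j i. \<Sum>\<pi>\<in>matchings (white_points k l) (black_points k l). a \<pi> * T_part k l \<pi> j i)"
proof -
  let ?M = "matchings (white_points k l) (black_points k l)"
  have supp: "supported k l T" and inter: "\<And>g. g \<in> unitary_group \<Longrightarrow> intertwines g k l T"
    using T by (simp_all add: tannaka_hom_classical unitary_group_nonempty)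
  have "gl_invariant (white_points k l) (black_points k l) (tens k l T)"
  proof (rule gl_invariant_of_invariant)
    show "tens k l T w = tens k l T w'" if "\<And>q. q \<in> points k l \<Longrightarrow> w q = w' q" for w w'
      using that by (rule tens_cong)
    show "invariant g (points k l) (pcolor k l) (tens k l T)" if "g \<in> unitary_group" for g
      using inter[OF that] intertwines_iff_invariant[OF that] by blast
  qed simp
  then have "tens k l T \<in> fam_span ?M block_const"
  proof (rule gl_invariant_in_span_matchings[rotated -1])
    show "tens k l T w = tens k l T w'"
      if "\<And>q. q \<in> white_points k l \<union> black_points k l \<Longrightarrow> w q = w' q" for w w'
      by (rule tens_cong, rule that) (simp only: white_black_points)
  qed (simp_all add: white_black_points(2))
  then obtain a where a: "\<And>w. tens k l T w = (\<Sum>\<pi>\<in>?M. a \<pi> * block_const \<pi> w)"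
    unfolding fam_span_def by blast
  have "T j i = (\<Sum>\<pi>\<in>?M. a \<pi> * T_part k l \<pi> j i)" for j i
  proof (cases "length j = length l \<and> length i = length k")
    case True
    then show ?thesis
      using a[of "case_sum ((!) i) ((!) j)"] by (simp add: tens_case_sum T_part_eq)
  next
    case False
    then have "T j i = 0" "T_part k l \<pi> j i = 0" for \<pi>
      using supp supported_T_part[of k l \<pi>] unfolding supported_def by blast+
    then show ?thesis by simp
  qed
  then show ?thesis by blast
qed

section \<open>Partitions for the determinant subgroups\<close>

text \<open>
  The factor by which the scalar matrix \<open>z\<close> acts on the tensor power \<open>k\<close>.
\<close>

definition color_weight :: "colored \<Rightarrow> complex \<Rightarrow> complex" where
  "color_weight k z = (\<Prod>n<length k. case k ! n of White \<Rightarrow> z | Black \<Rightarrow> cnj z)"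

lemma upow_scalar:
  "upow (\<chi> i j. z * g $ i $ j) k m i = color_weight k z * upow g k m i"
  unfolding upow_def color_weight_def prod.distrib[symmetric]
  by (intro prod.cong refl) (simp add: entry_def split: color.split)

lemma upow_diagonal:
  fixes D :: "complex^'n^'n"
  assumes D: "\<And>i j. D $ i $ j = (if i = j then d i else 0)"
    and len: "length m = length k" "length i = length k"
  shows "upow D k m i = (if m = i then \<Prod>n<length k. case k ! n of White \<Rightarrow> d (i ! n) | Black \<Rightarrow> cnj (d (i ! n)) else 0)"
proof (cases "m = i")
  case True
  then show ?thesis by (auto simp: upow_def entry_def D intro!: prod.cong split: color.split)
next
  case False
  then obtain n where "n < length k" "m ! n \<noteq> i ! n" using len by (metis nth_equalityI)
  then have "\<exists>n\<in>{..<length k}. entry D (k ! n) (m ! n) (i ! n) = 0"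
    by (intro bexI[of _ n]) (simp_all add: entry_def D split: color.split)
  then show ?thesis using False by (simp add: upow_def prod_zero)
qed

text \<open>
  The point of the argument is that a single \<open>T_\<pi>\<close> has the entry 1 at a constant word. For general
  intertwiners of the special unitary group, such as the determinant, the conclusion fails.
\<close>

lemma T_part_color_weight:
  assumes N: "CARD('n::finite) \<ge> 2" and z: "cmod z = 1"
    and \<pi>: "\<pi> \<in> partitions k l"
    and su: "\<And>g. g \<in> unitary_group \<Longrightarrow> det g = 1 \<Longrightarrow> intertwines (g :: complex^'n^'n) k l (T_part k l \<pi>)"
  shows "color_weight k z = color_weight l z"
proof -
  obtain a b :: 'n where ab: "a \<noteq> b"
    using N by (metis UNIV_I card_2_iff' card_le_Suc0_iff_eq finite not_less_eq_eq numeral_2_eq_2)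
  define d where "d i = (if i = a then z else if i = b then cnj z else 1)" for i
  define D :: "complex^'n^'n" where "D = (\<chi> i j. if i = j then d i else 0)"
  have D: "D $ i $ j = (if i = j then d i else 0)" for i j by (simp add: D_def)
  have zz: "z * cnj z = 1" using z by (metis complex_norm_square of_real_1 power_one)
  have dd: "d i * cnj (d i) = 1" for i using zz by (simp add: d_def mult.commute)
  have "D \<in> unitary_group"
  proof (rule unitary_groupI)
    fix i j
    have "(\<Sum>m\<in>UNIV. D $ i $ m * cnj (D $ j $ m)) = (\<Sum>m\<in>UNIV. if m = i then (if i = j then 1 else 0) else 0)"
      by (intro sum.cong) (auto simp: D dd)
    then show "(\<Sum>m\<in>UNIV. D $ i $ m * cnj (D $ j $ m)) = (if i = j then 1 else 0)" by simp
    have "(\<Sum>m\<in>UNIV. cnj (D $ m $ i) * D $ m $ j) = (\<Sum>m\<in>UNIV. if m = i then (if i = j then 1 else 0) else 0)"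
      using dd by (intro sum.cong) (auto simp: D mult.commute)
    then show "(\<Sum>m\<in>UNIV. cnj (D $ m $ i) * D $ m $ j) = (if i = j then 1 else 0)" by simp
  qed
  moreover have "det D = 1"
  proof -
    have "det D = (\<Prod>i\<in>UNIV. D $ i $ i)" by (rule det_diagonal) (simp add: D)
    also have "\<dots> = (\<Prod>i\<in>UNIV. d i)" by (simp add: D)
    also have "\<dots> = d a * (d b * prod d (UNIV - {a} - {b}))"
      using ab by (simp add: prod.remove[of UNIV a] prod.remove[of "UNIV - {a}" b])
    also have "prod d (UNIV - {a} - {b}) = 1" by (rule prod.neutral) (simp add: d_def)
    finally show ?thesis using ab zz by (simp add: d_def)
  qed
  ultimately have "intertwines D k l (T_part k l \<pi>)" by (rule su)
  define rl where "rl = replicate (length l) a"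
  define rk where "rk = replicate (length k) a"
  have len: "length rl = length l" "length rk = length k" by (simp_all add: rl_def rk_def)
  have T1: "T_part k l \<pi> rl rk = 1"
  proof -
    have "block_const \<pi> (case_sum ((!) rk) ((!) rl)) = block_const \<pi> (\<lambda>_. a)"
    proof (rule block_const_cong)
      show "partition_on (points k l) \<pi>" using \<pi> by (simp add: partitions_eq)
      show "case_sum ((!) rk) ((!) rl) q = a" if "q \<in> points k l" for q
        using that by (cases q) (simp_all add: rk_def rl_def)
    qed
    then show ?thesis by (simp add: T_part_eq[OF len] block_const_def)
  qed
  have upk: "upow D k m rk = (if m = rk then color_weight k z else 0)" if "length m = length k" for m
    unfolding upow_diagonal[OF D that len(2)] color_weight_def
    by (auto simp: rk_def d_def intro!: prod.cong split: color.split)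
  have upl: "upow D l rl m = (if m = rl then color_weight l z else 0)" if "length m = length l" for m
    unfolding upow_diagonal[OF D len(1) that] color_weight_def
    by (auto simp: rl_def d_def intro!: prod.cong split: color.split)
  have "(\<Sum>m | length m = length k. T_part k l \<pi> rl m * upow D k m rk) =
      (\<Sum>m | length m = length l. upow D l rl m * T_part k l \<pi> m rk)"
    using \<open>intertwines D k l (T_part k l \<pi>)\<close> len unfolding intertwines_def by blast
  also have "(\<Sum>m | length m = length k. T_part k l \<pi> rl m * upow D k m rk) =
      (\<Sum>m | length m = length k. if m = rk then color_weight k z else 0)"
    by (intro sum.cong) (auto simp: upk T1)
  also have "(\<Sum>m | length m = length l. upow D l rl m * T_part k l \<pi> m rk) =
      (\<Sum>m | length m = length l. if m = rl then color_weight l z else 0)"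
    by (intro sum.cong) (auto simp: upl T1)
  finally show ?thesis using len by (simp add: finite_words)
qed

lemma unitary_eq_scalar_times_special:
  fixes g :: "complex^'n^'n"
  assumes g: "g \<in> unitary_group"
  obtains z s where "cmod z = 1" "s \<in> unitary_group" "det s = 1" "g = (\<chi> i j. z * s $ i $ j)"
proof -
  define z where "z = cis (Arg (det g) / CARD('n))"
  have "det g \<noteq> 0" using cmod_det_unitary[OF g] by auto
  then have Arg: "cis (Arg (det g)) = det g"
    using cmod_det_unitary[OF g] by (simp add: cis_Arg sgn_div_norm)
  have "z ^ CARD('n) = cis (real CARD('n) * (Arg (det g) / real CARD('n)))"
    unfolding z_def by (rule Complex.DeMoivre)
  also have "\<dots> = cis (Arg (det g))" by simp
  finally have zN: "z ^ CARD('n) = det g" using Arg by simp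
  have zz: "z * cnj z = 1" by (simp add: z_def cis_cnj cis_mult)
  define s where "s = (\<chi> i j. cnj z * g $ i $ j)"
  have s: "s \<in> unitary_group"
  proof (rule unitary_groupI)
    fix i j
    have "(\<Sum>m\<in>UNIV. s $ i $ m * cnj (s $ j $ m)) = (z * cnj z) * (\<Sum>m\<in>UNIV. g $ i $ m * cnj (g $ j $ m))"
      unfolding sum_distrib_left by (simp add: s_def mult_ac)
    then show "(\<Sum>m\<in>UNIV. s $ i $ m * cnj (s $ j $ m)) = (if i = j then 1 else 0)"
      by (simp add: zz unitary_rows(1)[OF g])
    have "(\<Sum>m\<in>UNIV. cnj (s $ m $ i) * s $ m $ j) = (z * cnj z) * (\<Sum>m\<in>UNIV. cnj (g $ m $ i) * g $ m $ j)"
      unfolding sum_distrib_left by (simp add: s_def mult_ac)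
    then show "(\<Sum>m\<in>UNIV. cnj (s $ m $ i) * s $ m $ j) = (if i = j then 1 else 0)"
      by (simp add: zz unitary_rows(2)[OF g])
  qed
  have "s = mat (cnj z) ** g"
    by (simp add: s_def vec_eq_iff matrix_matrix_mult_def mat_def if_distrib[of "\<lambda>x. x * _"] cong: if_cong)
  moreover have "det (mat (cnj z) :: complex^'n^'n) = cnj z ^ CARD('n)"
    by (subst det_diagonal) (simp_all add: mat_def)
  ultimately have "det s = cnj (z ^ CARD('n)) * z ^ CARD('n)" by (simp add: det_mul flip: zN)
  also have "\<dots> = (z * cnj z) ^ CARD('n)" by (simp add: power_mult_distrib mult.commute)
  finally have "det s = 1" by (simp add: zz)
  moreover have "g = (\<chi> i j. z * s $ i $ j)"
    by (simp add: s_def vec_eq_iff zz flip: mult.assoc)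
  moreover have "cmod z = 1" by (simp add: z_def)
  ultimately show ?thesis using that s by blast
qed

lemma T_part_in_tannaka_hom_unitary_group:
  assumes N: "CARD('n::finite) \<ge> 2 \<or> d = \<infinity>" and \<pi>: "\<pi> \<in> partitions k l"
    and T: "T_part k l \<pi> \<in> tannaka_hom (classical (unitary_group_det d :: (complex^'n^'n) set)) k l"
  shows "T_part k l \<pi> \<in> tannaka_hom (classical (unitary_group :: (complex^'n^'n) set)) k l"
proof (cases "d = \<infinity>")
  case True
  then show ?thesis using T by (simp add: unitary_group_det_infinity)
next
  case False
  let ?T = "T_part k l \<pi> :: 'n list \<Rightarrow> 'n list \<Rightarrow> complex"
  have sub: "unitary_group_det d \<subseteq> unitary_group" "unitary_group_det d \<noteq> {}"
    using unitary_subgroup_unitary_group_det[of d] by (auto simp: unitary_subgroup_def)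
  have su: "intertwines s k l ?T" if "s \<in> unitary_group" "det s = 1" for s :: "complex^'n^'n"
  proof -
    have "s \<in> unitary_group_det d"
      using that by (auto simp: unitary_group_det_def root_group_def split: enat.split)
    then show ?thesis using T by (simp add: tannaka_hom_classical[OF sub])
  qed
  have "intertwines g k l ?T" if g: "g \<in> unitary_group" for g :: "complex^'n^'n"
  proof -
    obtain z s where zs: "cmod z = 1" "s \<in> unitary_group" "det s = 1" "g = (\<chi> i j. z * s $ i $ j)"
      using unitary_eq_scalar_times_special[OF g] .
    have weight: "color_weight k z = color_weight l z"
    proof (rule T_part_color_weight[OF _ zs(1) \<pi>])
      show "CARD('n) \<ge> 2" using N False by simp
    qed (rule su)
    show ?thesis
      unfolding intertwines_def
    proof (intro allI impI)
      fix j i :: "'n list" assume len: "length j = length l" "length i = length k"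
      have "(\<Sum>m | length m = length k. ?T j m * upow g k m i) =
          color_weight k z * (\<Sum>m | length m = length k. ?T j m * upow s k m i)"
        unfolding zs(4) upow_scalar sum_distrib_left by (simp add: mult_ac)
      also have "(\<Sum>m | length m = length k. ?T j m * upow s k m i) =
          (\<Sum>m | length m = length l. upow s l j m * ?T m i)"
        using su[OF zs(2,3)] len unfolding intertwines_def by blast
      also have "color_weight k z * \<dots> = (\<Sum>m | length m = length l. upow g l j m * ?T m i)"
        unfolding zs(4) upow_scalar weight sum_distrib_left by (simp add: mult_ac)
      finally show "(\<Sum>m | length m = length k. ?T j m * upow g k m i) =
          (\<Sum>m | length m = length l. upow g l j m * ?T m i)" .
    qed
  qed
  then show ?thesis
    by (simp add: tannaka_hom_classical unitary_group_nonempty supported_T_part)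
qed

section \<open>The easy envelope\<close>

lemma tannaka_hom_mono:
  assumes "H \<subseteq> G" "H \<noteq> {}" "G \<subseteq> unitary_group" "T \<in> tannaka_hom (classical G) k l"
  shows "T \<in> tannaka_hom (classical H) k l"
proof -
  have H: "H \<subseteq> unitary_group" and G: "G \<noteq> {}" using assms(1-3) by auto
  show ?thesis
    using assms(1,4)
    unfolding tannaka_hom_classical[OF H assms(2)] tannaka_hom_classical[OF assms(3) G] by blast
qed

lemma span_T_subset_tannaka_hom:
  fixes G :: "(complex^'n^'n) set"
  assumes G: "G \<subseteq> unitary_group" "G \<noteq> {}"
    and D: "\<And>\<pi>. \<pi> \<in> D \<Longrightarrow> T_part k l \<pi> \<in> tannaka_hom (classical G) k l"
  shows "span_T k l D \<subseteq> tannaka_hom (classical G) k l"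
proof
  fix T :: "'n list \<Rightarrow> 'n list \<Rightarrow> complex"
  assume "T \<in> span_T k l D"
  then obtain a where T: "T = (\<lambda>j i. \<Sum>\<pi>\<in>D. a \<pi> * T_part k l \<pi> j i)" by (auto simp: span_T_def)
  have "supported k l T"
    unfolding supported_def
  proof (intro allI impI, rule ccontr)
    fix j i assume ne: "T j i \<noteq> 0" and "\<not> (length j = length l \<and> length i = length k)"
    then have "T_part k l \<pi> j i = 0" for \<pi>
      using supported_T_part[of k l \<pi>] unfolding supported_def by blast
    then show False using ne by (simp add: T)
  qed
  moreover have "intertwines g k l T" if g: "g \<in> G" for g
    unfolding intertwines_def
  proof (intro allI impI)
    fix j i :: "'n list" assume len: "length j = length l" "length i = length k"
    have "(\<Sum>m | length m = length k. T j m * upow g k m i) =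
        (\<Sum>\<pi>\<in>D. a \<pi> * (\<Sum>m | length m = length k. T_part k l \<pi> j m * upow g k m i))"
      unfolding T sum_distrib_right sum_distrib_left by (subst sum.swap) (simp add: mult_ac)
    also have "\<dots> = (\<Sum>\<pi>\<in>D. a \<pi> * (\<Sum>m | length m = length l. upow g l j m * T_part k l \<pi> m i))"
    proof (intro sum.cong refl)
      fix \<pi> assume "\<pi> \<in> D"
      then have "intertwines g k l (T_part k l \<pi>)"
        using D g by (simp add: tannaka_hom_classical[OF G])
      then show "a \<pi> * (\<Sum>m | length m = length k. T_part k l \<pi> j m * upow g k m i) =
          a \<pi> * (\<Sum>m | length m = length l. upow g l j m * T_part k l \<pi> m i)"
        using len by (simp add: intertwines_def)
    qed
    also have "\<dots> = (\<Sum>m | length m = length l. upow g l j m * T m i)"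
      unfolding T sum_distrib_right sum_distrib_left by (subst sum.swap) (simp add: mult_ac)
    finally show "(\<Sum>m | length m = length k. T j m * upow g k m i) =
        (\<Sum>m | length m = length l. upow g l j m * T m i)" .
  qed
  ultimately show "T \<in> tannaka_hom (classical G) k l"
    by (simp add: tannaka_hom_classical[OF G])
qed

theorem proposition3p3:
  fixes d :: enat
  assumes "d \<ge> 1"
    and "CARD('n::finite) \<ge> 2 \<or> d = \<infinity>"
  shows "is_easy_envelope (classical (unitary_group_det d :: (complex^'n^'n) set))
                          (classical (unitary_group :: (complex^'n^'n) set))"
proof -
  let ?U = "unitary_group :: (complex^'n^'n) set" and ?Ud = "unitary_group_det d :: (complex^'n^'n) set"
  have Ud: "?Ud \<subseteq> ?U" "?Ud \<noteq> {}"
    using unitary_subgroup_unitary_group_det[of d] by (auto simp: unitary_subgroup_def)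
  have "tannaka_hom (classical ?U) k l = span_T k l (D1 (classical ?Ud) k l)" for k l
  proof (rule antisym)
    show "span_T k l (D1 (classical ?Ud) k l) \<subseteq> tannaka_hom (classical ?U) k l"
      using assms(2)
      by (intro span_T_subset_tannaka_hom subset_refl unitary_group_nonempty)
        (auto simp: D1_def intro: T_part_in_tannaka_hom_unitary_group)
    show "tannaka_hom (classical ?U) k l \<subseteq> span_T k l (D1 (classical ?Ud) k l)"
    proof
      fix T assume "T \<in> tannaka_hom (classical ?U) k l"
      then obtain a where T: "T = (\<lambda>j i.
          \<Sum>\<pi>\<in>matchings (white_points k l) (black_points k l). a \<pi> * T_part k l \<pi> j i)"
        using tannaka_hom_unitary_group_span by blast
      let ?M = "matchings (white_points k l) (black_points k l)" and ?D = "D1 (classical ?Ud) k l"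
      have MD: "?M \<subseteq> ?D"
      proof
        fix \<pi> assume "\<pi> \<in> ?M"
        note * = matching_T_part_in_tannaka_hom[OF this]
        then show "\<pi> \<in> ?D"
          using tannaka_hom_mono[OF Ud subset_refl *(2)] by (simp add: D1_def)
      qed
      have fin: "finite ?D"
        by (rule finite_subset[OF _ finite_partitions[of k l]]) (auto simp: D1_def)
      have "T j i = (\<Sum>\<pi>\<in>?D. (if \<pi> \<in> ?M then a \<pi> else 0) * T_part k l \<pi> j i)" for j i
        unfolding T by (intro sum.mono_neutral_cong_left fin MD) auto
      then have "T = (\<lambda>j i. \<Sum>\<pi>\<in>?D. (if \<pi> \<in> ?M then a \<pi> else 0) * T_part k l \<pi> j i)"
        by (intro ext)
      then show "T \<in> span_T k l ?D" unfolding span_T_def by (intro CollectI exI)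
    qed
  qed
  then show ?thesis
    unfolding is_easy_envelope_def
    by (simp add: closed_quantum_subgroup_classical unitary_subgroup_unitary_group
        unitary_subgroup_unitary_group_det classical_mono permutation_group_subset
        permutation_group_nonempty)
qed

end
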